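(* Let $I_{i,\alpha}\subseteq[M]$ be nonempty sets, for $i\in[M]$, $\alpha\in\mathbb{N}^N_*$, and consider the SDSE $$(S):\ \forall i\in[M],\quad X_i=\sum_{\alpha\in\mathbb{N}^N_*}B_{i,\alpha}\Big(1+\sum_{j\in I_{i,\alpha}}X_j\Big).$$ It is Hopf if, and only if, there exists an $N$-coloured Hopf graph $G$ on the vertex set $[M]$ such that $(S)$ is equal to $(S_G)$. If this holds, the dual pre-Lie algebra of $\mathcal{H}_{(S_G)}$ is associative; it has a basis $(f_i(\alpha))_{i\in V(G),\alpha\in\mathbb{N}^N_*}$ and its product is given by $$f_j(\beta)*f_i(\alpha)=\begin{cases}f_i(\alpha+\beta)&\text{if } i\xrightarrow{\alpha}j,\\0&\text{otherwise.}\end{cases}$$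
   Context: $\mathbb{K}$ is a field of characteristic zero; $M,N\ge1$, $[M]=\{1,\dots,M\}$, $\mathbb{N}^N_*=\mathbb{N}^N\setminus\{0\}$. For a set $D$, $\mathcal{H}^D$ is the free commutative algebra generated by isoclasses of rooted trees with vertices decorated by $D$; its basis is the set of decorated rooted forests. For $d\in D$, $B_d$ is the linear map sending a forest to the tree obtained by grafting all its trees on a common root decorated by $d$. The coproduct of $\mathcal{H}^D$ is the unique algebra morphism with $\Delta\circ B_d(x)=B_d(x)\otimes1+(\mathrm{Id}\otimes B_d)\circ\Delta(x)$. $B_d$ extends to the algebra $\widehat{\mathcal{H}^D}$ of formal series of forests. Here $D=[M]\times\mathbb{N}^N_*$, $B_{i,\alpha}=B_{(i,\alpha)}$, and $(i,\alpha)$ has degree $\alpha$; the degree of a forest is the sum of the degrees of its decorations. The system has a unique solution $(X_1,\dots,X_M)\in\widehat{\mathcal{H}^D}^M$; $X_i(\alpha)$ denotes the homogeneous component of $X_i$ of degree $\alpha$, and $\mathcal{H}_{(S)}$ the subalgebra of $\mathcal{H}^D$ generated by all the $X_i(\alpha)$. $(S)$ is Hopf if $\mathcal{H}_{(S)}$ is a Hopf subalgebra. An $N$-coloured oriented graph is an oriented graph $G$ (loops and several edges of different colours between two vertices are allowed) with a map from its set of edges to $[N]$; $V(G)$ is its set of vertices. For $i,j\in V(G)$ and $\alpha=(\alpha_1,\dots,\alpha_N)\in\mathbb{N}^N$, $i\xrightarrow{\alpha}j$ means that there is an oriented path from $i$ to $j$ in $G$ with exactly $\alpha_p$ edges of colour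 $p$ for all $p\in[N]$. The SDSE associated to $G$ is $$(S_G):\ \forall i\in V(G),\quad X_i=\sum_{\alpha\in\mathbb{N}^N_*}B_{i,\alpha}\Big(1+\sum_{j:\ i\xrightarrow{\alpha}j}X_j\Big).$$ $G$ is Hopf if for all $i,j,k\in V(G)$ and $\alpha,\beta\in\mathbb{N}^N_*$: $(i\xrightarrow{\alpha}j$ and $j\xrightarrow{\beta}k)\Longleftrightarrow(i\xrightarrow{\alpha}j$ and $i\xrightarrow{\alpha+\beta}k)$. A (left) pre-Lie algebra is a vector space with a bilinear product $*$ such that $(x*y)*z-x*(y*z)=(y*x)*z-y*(x*z)$; $[x,y]=x*y-y*x$ is then a Lie bracket. When $(S)$ is Hopf, the graded dual of $\mathcal{H}_{(S)}$ is the enveloping algebra of a pre-Lie algebra, called the dual pre-Lie algebra of $\mathcal{H}_{(S)}$, with basis the elements $f_i(\alpha)$ dual to the generators $X_i(\alpha)$. Its product is determined as follows: the coefficient of $f_i(\alpha+\beta)$ in $f_j(\beta)*f_i(\alpha)$ is the coefficient of $X_j(\beta)\otimes X_i(\alpha)$ in $\Delta(X_i(\alpha+\beta))-X_i(\alpha+\beta)\otimes1$, the left tensor factor being expanded in monomials in the generators and the right one being a linear combination of the generators $X_i(\gamma)$. *)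

theory Defs
  imports
    "HOL-Library.Multiset"
    "HOL-Library.Poly_Mapping"
    "HOL-Library.Product_Plus"
    "HOL-Library.Function_Algebras"
    "HOL-Analysis.Finite_Cartesian_Product"
begin

section \<open>Multi-degrees\<close>

typedef (overloaded) ('n::finite) mdeg = "{\<alpha> :: nat ^ 'n. \<alpha> \<noteq> 0}"
  morphisms mvec Abs_mdeg
  by (rule exI[of _ 1]) (simp add: vec_eq_iff)

lemma mdeg_add_nonzero: "(a :: nat ^ 'n::finite) \<noteq> 0 \<Longrightarrow> a + b \<noteq> 0"
  by (auto simp: vec_eq_iff)

instantiation mdeg :: (finite) ab_semigroup_add
begin

definition plus_mdeg :: "'a mdeg \<Rightarrow> 'a mdeg \<Rightarrow> 'a mdeg" where
  "\<alpha> + \<beta> = Abs_mdeg (mvec \<alpha> + mvec \<beta>)"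

lemma mvec_add: "mvec (\<alpha> + \<beta>) = mvec \<alpha> + mvec \<beta>" for \<alpha> \<beta> :: "'a mdeg"
  using mvec[of \<alpha>] by (simp add: plus_mdeg_def Abs_mdeg_inverse mdeg_add_nonzero)

instance
  by standard (simp_all add: mvec_inject[symmetric] mvec_add ac_simps)

end


section \<open>Finitely supported functions as vector spaces\<close>

definition pm_scale :: "'k::field \<Rightarrow> ('a \<Rightarrow>\<^sub>0 'k) \<Rightarrow> ('a \<Rightarrow>\<^sub>0 'k)" where
  "pm_scale c p = Poly_Mapping.map ((*) c) p"

lemma lookup_pm_scale [simp]:
  "Poly_Mapping.lookup (pm_scale c p) x = c * Poly_Mapping.lookup p x"
  by (simp add: pm_scale_def Poly_Mapping.map.rep_eq when_def)

global_interpretation pm: vector_space pm_scale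
  by standard (rule poly_mapping_eqI, simp add: lookup_add algebra_simps)+

definition fun_scale :: "'k::field \<Rightarrow> ('a \<Rightarrow> 'k) \<Rightarrow> ('a \<Rightarrow> 'k)" where
  "fun_scale c f = (\<lambda>x. c * f x)"

global_interpretation fn: vector_space fun_scale
  by standard (simp_all add: fun_scale_def fun_eq_iff algebra_simps)

definition lin_ext :: "('a \<Rightarrow> 'b \<Rightarrow>\<^sub>0 'k) \<Rightarrow> ('a \<Rightarrow>\<^sub>0 'k::field) \<Rightarrow> ('b \<Rightarrow>\<^sub>0 'k)" where
  "lin_ext f p = (\<Sum>a\<in>Poly_Mapping.keys p. pm_scale (Poly_Mapping.lookup p a) (f a))"

lemma lin_ext_superset:
  assumes "finite A" "Poly_Mapping.keys p \<subseteq> A"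
  shows "lin_ext f p = (\<Sum>a\<in>A. pm_scale (Poly_Mapping.lookup p a) (f a))"
  unfolding lin_ext_def using assms
  by (intro sum.mono_neutral_left) (auto simp: in_keys_iff)

lemma lin_ext_add: "lin_ext f (p + q) = lin_ext f p + lin_ext f q"
proof -
  let ?A = "Poly_Mapping.keys p \<union> Poly_Mapping.keys q"
  have "Poly_Mapping.keys (p + q) \<subseteq> ?A" by (rule Poly_Mapping.keys_add)
  then show ?thesis
    by (simp add: lin_ext_superset[of ?A] lookup_add pm.scale_left_distrib sum.distrib)
qed

lemma lin_ext_scale: "lin_ext f (pm_scale c p) = pm_scale c (lin_ext f p)"
proof -
  have "Poly_Mapping.keys (pm_scale c p) \<subseteq> Poly_Mapping.keys p" by (auto simp: in_keys_iff)
  then show ?thesis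
    by (simp add: lin_ext_superset[of "Poly_Mapping.keys p"] pm.scale_sum_right)
qed

lemma lin_ext_single [simp]: "lin_ext f (Poly_Mapping.single a c) = pm_scale c (f a)"
  by (simp add: lin_ext_superset[of "{a}"])

lemma lin_ext_0 [simp]: "lin_ext f 0 = 0"
  by (simp add: lin_ext_def)

lemma lin_ext_linear: "Vector_Spaces.linear pm_scale pm_scale (lin_ext f)"
  by unfold_locales (simp_all add: lin_ext_add lin_ext_scale)

lemma pm_induct [case_names zero add]:
  assumes "P 0" "\<And>a c p. P p \<Longrightarrow> P (Poly_Mapping.single a c + p)"
  shows "P (p :: 'a \<Rightarrow>\<^sub>0 'k::field)"
proof (induction p rule: update_induct)
  case const
  show ?case using assms(1) by simp
next
  case (update f a b)
  have "Poly_Mapping.update a b f = Poly_Mapping.single a b + f"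
    using update(1) by (intro poly_mapping_eqI)
      (auto simp: lookup_update lookup_add lookup_single when_def in_keys_iff)
  with assms(2) update show ?case by simp
qed

lemma pm_scale_mult_left: "pm_scale c p * q = pm_scale c (p * q)"
  and pm_scale_mult_right: "p * pm_scale c q = pm_scale c (p * q)"
  for p q :: "'a::comm_monoid_add \<Rightarrow>\<^sub>0 'k::field"
  by (simp_all only: pm_scale_def mult_map_scale_conv_mult mult.left_commute mult.assoc)

lemma lin_ext_mult:
  fixes f :: "'a::comm_monoid_add \<Rightarrow> 'b::comm_monoid_add \<Rightarrow>\<^sub>0 'k::field"
  assumes "\<And>a b. f (a + b) = f a * f b"
  shows "lin_ext f (p * q) = lin_ext f p * lin_ext f q"
proof -
  have 1: "lin_ext f (Poly_Mapping.single a c * q) = pm_scale c (f a) * lin_ext f q" for a c q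
    by (induction q rule: pm_induct)
      (simp_all add: distrib_left lin_ext_add mult_single assms pm_scale_mult_left pm_scale_mult_right)
  show ?thesis
    by (induction p rule: pm_induct) (simp_all add: distrib_right lin_ext_add 1)
qed

text \<open>The tensor product of the free vector spaces on \<open>'a\<close> and \<open>'b\<close> is the free vector space
  on \<open>'a \<times> 'b\<close>.\<close>

definition tensor :: "('a \<Rightarrow>\<^sub>0 'k::field) \<Rightarrow> ('b \<Rightarrow>\<^sub>0 'k) \<Rightarrow> ('a \<times> 'b \<Rightarrow>\<^sub>0 'k)" where
  "tensor p q = lin_ext (\<lambda>a. lin_ext (\<lambda>b. Poly_Mapping.single (a, b) 1) q) p"

definition tensor_sub ::
  "('a \<Rightarrow>\<^sub>0 'k::field) set \<Rightarrow> ('b \<Rightarrow>\<^sub>0 'k) set \<Rightarrow> ('a \<times> 'b \<Rightarrow>\<^sub>0 'k) set" where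
  "tensor_sub A B = pm.span {tensor a b |a b. a \<in> A \<and> b \<in> B}"


section \<open>The Hopf algebra of decorated rooted forests\<close>

datatype 'd rtree = Node 'd "'d rtree multiset"

type_synonym 'd forest = "'d rtree multiset"

text \<open>The algebra of forests is \<open>'d forest \<Rightarrow>\<^sub>0 'k\<close>; as addition of multisets is the disjoint union of
  forests, the convolution product of \<open>Poly_Mapping\<close> is the free commutative product. Likewise
  \<open>'d forest \<times> 'd forest \<Rightarrow>\<^sub>0 'k\<close> carries the product of the tensor square.\<close>

definition graft :: "'d \<Rightarrow> ('d forest \<Rightarrow>\<^sub>0 'k::field) \<Rightarrow> ('d forest \<Rightarrow>\<^sub>0 'k)" where
  "graft d = lin_ext (\<lambda>F. Poly_Mapping.single {#Node d F#} 1)"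

definition id_tensor_graft ::
  "'d \<Rightarrow> ('d forest \<times> 'd forest \<Rightarrow>\<^sub>0 'k::field) \<Rightarrow> ('d forest \<times> 'd forest \<Rightarrow>\<^sub>0 'k)" where
  "id_tensor_graft d = lin_ext (\<lambda>(F, G). tensor (Poly_Mapping.single F 1) (graft d (Poly_Mapping.single G 1)))"

primrec coproduct_tree :: "'d rtree \<Rightarrow> ('d forest \<times> 'd forest \<Rightarrow>\<^sub>0 'k::field)" where
  "coproduct_tree (Node d F) =
     tensor (Poly_Mapping.single {#Node d F#} 1) 1
     + id_tensor_graft d (prod_mset (image_mset coproduct_tree F))"

definition coproduct :: "('d forest \<Rightarrow>\<^sub>0 'k::field) \<Rightarrow> ('d forest \<times> 'd forest \<Rightarrow>\<^sub>0 'k)" where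
  "coproduct = lin_ext (\<lambda>F. prod_mset (image_mset coproduct_tree F))"

text \<open>\<open>coproduct\<close> is the unique algebra morphism satisfying the cocycle equation for all graftings.\<close>

lemma tensor_add_left: "tensor (p + p') q = tensor p q + tensor p' q"
  by (simp add: tensor_def lin_ext_add)

lemma tensor_scale_left: "tensor (pm_scale c p) q = pm_scale c (tensor p q)"
  by (simp add: tensor_def lin_ext_scale)

lemma coproduct_linear: "Vector_Spaces.linear pm_scale pm_scale (coproduct :: ('d forest \<Rightarrow>\<^sub>0 'k::field) \<Rightarrow> _)"
  unfolding coproduct_def by (rule lin_ext_linear)

lemma coproduct_1: "coproduct (1 :: 'd forest \<Rightarrow>\<^sub>0 'k::field) = 1"
  using lin_ext_single[of "\<lambda>F. prod_mset (image_mset coproduct_tree F)" 0 1]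
  by (simp add: coproduct_def)

lemma coproduct_mult: "coproduct (x * y) = coproduct x * coproduct (y :: 'd forest \<Rightarrow>\<^sub>0 'k::field)"
  unfolding coproduct_def by (rule lin_ext_mult) simp

lemma coproduct_graft:
  "coproduct (graft d x) = tensor (graft d x) 1 + id_tensor_graft d (coproduct (x :: 'd forest \<Rightarrow>\<^sub>0 'k::field))"
  by (induction x rule: pm_induct)
    (simp_all add: graft_def id_tensor_graft_def coproduct_def lin_ext_add lin_ext_scale
       tensor_add_left tensor_scale_left pm.scale_right_distrib, simp add: tensor_def)

lemma coproduct_unique:
  fixes \<Delta> :: "('d forest \<Rightarrow>\<^sub>0 'k::field) \<Rightarrow> _"
  assumes "Vector_Spaces.linear pm_scale pm_scale \<Delta>" "\<Delta> 1 = 1" "\<And>x y. \<Delta> (x * y) = \<Delta> x * \<Delta> y"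
    and B: "\<And>d x. \<Delta> (graft d x) = tensor (graft d x) 1 + id_tensor_graft d (\<Delta> x)"
  shows "\<Delta> = coproduct"
proof -
  interpret D: Vector_Spaces.linear pm_scale pm_scale \<Delta> by fact
  have forest: "\<Delta> (Poly_Mapping.single F 1) = prod_mset (image_mset (\<lambda>t. \<Delta> (Poly_Mapping.single {#t#} 1)) F)" for F
  proof (induction F)
    case empty
    have "\<Delta> (Poly_Mapping.single 0 1) = 1" using assms(2) by simp
    then show ?case by (simp del: single_one)
  next
    case (add t F)
    have "Poly_Mapping.single (add_mset t F) (1::'k) = Poly_Mapping.single {#t#} 1 * Poly_Mapping.single F 1"
      by (simp add: mult_single)
    then show ?case by (simp only: assms(3) add image_mset_add_mset prod_mset.add_mset)
  qed
  have tree: "\<Delta> (Poly_Mapping.single {#t#} 1) = coproduct_tree t" for t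
  proof (induction t)
    case (Node d F)
    have *: "{#\<Delta> (Poly_Mapping.single {#t#} 1). t \<in># F#} = image_mset coproduct_tree F"
      by (rule image_mset_cong) (use Node in auto)
    have "Poly_Mapping.single {#Node d F#} (1::'k) = graft d (Poly_Mapping.single F 1)"
      by (simp add: graft_def)
    with B[of d "Poly_Mapping.single F 1", unfolded forest[of F] *] show ?case
      by (simp only: coproduct_tree.simps)
  qed
  have "\<Delta> (Poly_Mapping.single F c) = coproduct (Poly_Mapping.single F c)" for F c
  proof -
    have "Poly_Mapping.single F c = pm_scale c (Poly_Mapping.single F 1)"
      by (rule poly_mapping_eqI) (simp add: lookup_single when_def)
    then show ?thesis
      by (simp only: D.scale forest[of F, unfolded tree] coproduct_def lin_ext_scale lin_ext_single pm.scale_one)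
  qed
  then have "\<Delta> x = coproduct x" for x
    by (induction x rule: pm_induct) (simp_all only: D.zero D.add coproduct_def lin_ext_add lin_ext_0)
  then show ?thesis by (rule ext)
qed

definition counit :: "('d forest \<Rightarrow>\<^sub>0 'k::field) \<Rightarrow> 'k" where
  "counit x = Poly_Mapping.lookup x {#}"

definition conv ::
  "(('d forest \<Rightarrow>\<^sub>0 'k) \<Rightarrow> ('d forest \<Rightarrow>\<^sub>0 'k)) \<Rightarrow> (('d forest \<Rightarrow>\<^sub>0 'k) \<Rightarrow> ('d forest \<Rightarrow>\<^sub>0 'k))
     \<Rightarrow> ('d forest \<Rightarrow>\<^sub>0 'k::field) \<Rightarrow> ('d forest \<Rightarrow>\<^sub>0 'k)" where
  "conv f g x = lin_ext (\<lambda>(F, G). f (Poly_Mapping.single F 1) * g (Poly_Mapping.single G 1)) (coproduct x)"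

definition is_antipode :: "(('d forest \<Rightarrow>\<^sub>0 'k::field) \<Rightarrow> ('d forest \<Rightarrow>\<^sub>0 'k)) \<Rightarrow> bool" where
  "is_antipode s \<longleftrightarrow> Vector_Spaces.linear pm_scale pm_scale s \<and>
     (\<forall>x. conv s id x = pm_scale (counit x) 1 \<and> conv id s x = pm_scale (counit x) 1)"

definition subalgebra :: "('d forest \<Rightarrow>\<^sub>0 'k::field) set \<Rightarrow> bool" where
  "subalgebra A \<longleftrightarrow> pm.subspace A \<and> 1 \<in> A \<and> (\<forall>x\<in>A. \<forall>y\<in>A. x * y \<in> A)"

text \<open>The antipode is the convolution inverse of the identity, so that at most one \<open>s\<close> is concerned
  by the last condition.\<close>

definition hopf_subalgebra :: "('d forest \<Rightarrow>\<^sub>0 'k::field) set \<Rightarrow> bool" where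
  "hopf_subalgebra A \<longleftrightarrow> subalgebra A \<and> coproduct ` A \<subseteq> tensor_sub A A \<and>
     (\<forall>s. is_antipode s \<longrightarrow> s ` A \<subseteq> A)"


section \<open>Systems of Dyson-Schwinger equations\<close>

text \<open>A formal series of forests is an arbitrary function on forests. A system is given by its
  right-hand side, as an operator on families of series.\<close>

type_synonym ('d, 'k) series = "'d forest \<Rightarrow> 'k"

type_synonym ('m, 'n, 'k) sdse =
  "('m \<Rightarrow> ('m \<times> 'n mdeg, 'k) series) \<Rightarrow> 'm \<Rightarrow> ('m \<times> 'n mdeg, 'k) series"

text \<open>Not \<open>1\<close>, which for the pointwise structure on functions is the constant function.\<close>

definition series_one :: "('d, 'k::field) series" where
  "series_one F = (if F = {#} then 1 else 0)"

definition graft_series :: "'d \<Rightarrow> ('d, 'k::field) series \<Rightarrow> ('d, 'k) series" where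
  "graft_series d f = (\<lambda>F. \<Sum>G | {#Node d G#} = F. f G)"

text \<open>The sum over \<open>\<alpha>\<close> is taken coefficientwise: at each forest at most one \<open>\<alpha>\<close> contributes.\<close>

definition linear_sdse ::
  "('m \<Rightarrow> 'n::finite mdeg \<Rightarrow> 'm set) \<Rightarrow> ('m, 'n, 'k::field) sdse" where
  "linear_sdse I X i =
     (\<lambda>F. Sum_any (\<lambda>\<alpha>. graft_series (i, \<alpha>) (series_one + (\<Sum>j\<in>I i \<alpha>. X j)) F))"

lemma graft_series_simps:
  "graft_series d f {#Node e G#} = (if d = e then f G else 0)"
  "(\<And>G. F \<noteq> {#Node d G#}) \<Longrightarrow> graft_series d f F = 0"
proof -
  have *: "{G'. {#Node d G'#} = {#Node e G#}} = (if d = e then {G} else {})" by auto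
  show "graft_series d f {#Node e G#} = (if d = e then f G else 0)"
    unfolding graft_series_def * by simp
  show "graft_series d f F = 0" if "\<And>G. F \<noteq> {#Node d G#}"
  proof -
    have "{G. {#Node d G#} = F} = {}" using that by auto
    then show ?thesis by (simp add: graft_series_def)
  qed
qed


lemma sum_fun_apply: "(\<Sum>j\<in>A. f j) x = (\<Sum>j\<in>A. f j x)"
  by (induction A rule: infinite_finite_induct) auto

lemma linear_sdse_tree:
  "linear_sdse I X i {#Node (k, \<alpha>) G#} = (if k = i then series_one G + (\<Sum>j\<in>I i \<alpha>. X j G) else 0)"
proof -
  let ?c = "series_one G + (\<Sum>j\<in>I i \<alpha>. X j G)"
  have "linear_sdse I X i {#Node (k, \<alpha>) G#} = Sum_any (\<lambda>\<beta>. if \<beta> = \<alpha> then (if k = i then ?c else 0) else 0)"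
    unfolding linear_sdse_def
    by (intro arg_cong[where f = Sum_any] ext) (auto simp: graft_series_simps sum_fun_apply)
  also have "\<dots> = (if k = i then ?c else 0)"
    by (rule Sum_any.delta)
  finally show ?thesis .
qed

lemma linear_sdse_not_tree:
  "(\<And>d G. F \<noteq> {#Node d G#}) \<Longrightarrow> linear_sdse I X i F = 0"
  by (simp add: linear_sdse_def graft_series_simps(2))

primrec nodes :: "'d rtree \<Rightarrow> nat" where
  "nodes (Node d F) = Suc (sum_mset (image_mset nodes F))"

lemma linear_sdse_cong:
  assumes "\<And>j G. sum_mset (image_mset nodes G) < sum_mset (image_mset nodes F) \<Longrightarrow> X j G = Y j G"
  shows "linear_sdse I X i F = linear_sdse I Y i F"
proof (cases "\<exists>d G. F = {#Node d G#}")
  case True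
  then obtain k \<alpha> G where "F = {#Node (k, \<alpha>) G#}" by auto
  with assms show ?thesis by (auto simp: linear_sdse_tree intro!: sum.cong)
next
  case False
  then have "\<And>d G. F \<noteq> {#Node d G#}" by blast
  then have "linear_sdse I X i F = 0" "linear_sdse I Y i F = 0"
    by (blast intro: linear_sdse_not_tree)+
  then show ?thesis by simp
qed

lemma linear_sdse_ex1:
  fixes I :: "'m \<Rightarrow> 'n::finite mdeg \<Rightarrow> 'm set"
  shows "\<exists>!X :: 'm \<Rightarrow> ('m \<times> 'n mdeg, 'k::field) series. X = linear_sdse I X"
proof (rule ex_ex1I)
  let ?n = "\<lambda>F :: ('m \<times> 'n mdeg) forest. sum_mset (image_mset nodes F)"
  let ?Z = "\<lambda>n. (linear_sdse I ^^ n) 0 :: 'm \<Rightarrow> ('m \<times> 'n mdeg, 'k) series"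
  have stable: "?Z (Suc m) i F = ?Z (Suc n) i F" if "?n F \<le> n" "?n F \<le> m" for n m i F
    using that
  proof (induction "?n F" arbitrary: n m i F rule: less_induct)
    case less
    have "linear_sdse I (?Z m) i F = linear_sdse I (?Z n) i F"
    proof (rule linear_sdse_cong)
      fix j and G :: "('m \<times> 'n mdeg) forest" assume G: "?n G < ?n F"
      then have "0 < m" "0 < n" using less.prems by linarith+
      then obtain m' n' where "m = Suc m'" "n = Suc n'" by (auto simp: gr0_conv_Suc)
      with less.hyps[OF G, of n' m'] less.prems G show "?Z m j G = ?Z n j G" by simp
    qed
    then show ?case by simp
  qed
  define X where "X = (\<lambda>i F. ?Z (Suc (?n F)) i F)"
  have "X i F = linear_sdse I X i F" for i F
  proof -
    have "X i F = linear_sdse I (?Z (?n F)) i F" by (simp add: X_def)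
    also have "\<dots> = linear_sdse I X i F"
    proof (rule linear_sdse_cong)
      fix j and G :: "('m \<times> 'n mdeg) forest" assume G: "?n G < ?n F"
      then obtain n' where n': "?n F = Suc n'" by (cases "?n F") auto
      with stable[of G n' "?n G" j] G show "?Z (?n F) j G = X j G" by (simp add: X_def)
    qed
    finally show ?thesis .
  qed
  then have "X = linear_sdse I X" by (intro ext)
  then show "\<exists>X :: 'm \<Rightarrow> ('m \<times> 'n mdeg, 'k) series. X = linear_sdse I X" by (rule exI[of _ X])
next
  fix X Y :: "'m \<Rightarrow> ('m \<times> 'n mdeg, 'k) series" assume X: "X = linear_sdse I X" and Y: "Y = linear_sdse I Y"
  have "X i F = Y i F" for i F
  proof (induction "sum_mset (image_mset nodes F)" arbitrary: i F rule: less_induct)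
    case less
    have "X i F = linear_sdse I X i F" by (rule fun_cong[OF fun_cong[OF X]])
    also have "\<dots> = linear_sdse I Y i F" by (rule linear_sdse_cong) (rule less)
    also have "\<dots> = Y i F" by (rule fun_cong[OF fun_cong[OF Y], symmetric])
    finally show ?case .
  qed
  then show "X = Y" by (intro ext)
qed

definition solution :: "('m, 'n, 'k::field) sdse \<Rightarrow> 'm \<Rightarrow> ('m \<times> 'n::finite mdeg, 'k) series" where
  "solution S = (THE X. X = S X)"

lemma solution_eq:
  fixes I :: "'m \<Rightarrow> 'n::finite mdeg \<Rightarrow> 'm set"
  shows "solution (linear_sdse I :: ('m, 'n, 'k::field) sdse) = linear_sdse I (solution (linear_sdse I))"
  unfolding solution_def by (rule theI'[OF linear_sdse_ex1])

primrec tree_deg :: "('m \<times> 'n::finite mdeg) rtree \<Rightarrow> nat ^ 'n" where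
  "tree_deg (Node d F) = mvec (snd d) + sum_mset (image_mset tree_deg F)"

definition forest_deg :: "('m \<times> 'n::finite mdeg) forest \<Rightarrow> nat ^ 'n" where
  "forest_deg F = sum_mset (image_mset tree_deg F)"

definition hom_component ::
  "('m \<times> 'n::finite mdeg, 'k::field) series \<Rightarrow> nat ^ 'n \<Rightarrow> (('m \<times> 'n mdeg) forest \<Rightarrow>\<^sub>0 'k)" where
  "hom_component f \<delta> = Abs_poly_mapping (\<lambda>F. if forest_deg F = \<delta> then f F else 0)"

definition gen ::
  "('m, 'n, 'k::field) sdse \<Rightarrow> 'm \<Rightarrow> 'n::finite mdeg \<Rightarrow> (('m \<times> 'n mdeg) forest \<Rightarrow>\<^sub>0 'k)" where
  "gen S i \<alpha> = hom_component (solution S i) (mvec \<alpha>)"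

definition H_sub ::
  "('m, 'n, 'k::field) sdse \<Rightarrow> (('m \<times> 'n::finite mdeg) forest \<Rightarrow>\<^sub>0 'k) set" where
  "H_sub S = subalgebra hull {gen S i \<alpha> |i \<alpha>. True}"

definition hopf_sdse :: "('m, 'n::finite, 'k::field) sdse \<Rightarrow> bool" where
  "hopf_sdse S \<longleftrightarrow> hopf_subalgebra (H_sub S)"


section \<open>Coloured graphs\<close>

text \<open>A graph on the vertex set \<open>'v\<close> is its set of edges (source, colour, target).\<close>

type_synonym ('v, 'n) cgraph = "('v \<times> 'n \<times> 'v) set"

fun walk :: "('v, 'n) cgraph \<Rightarrow> 'v \<Rightarrow> ('v \<times> 'n \<times> 'v) list \<Rightarrow> 'v \<Rightarrow> bool" where
  "walk G i [] j \<longleftrightarrow> i = j"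
| "walk G i ((u, p, v) # es) j \<longleftrightarrow> u = i \<and> (u, p, v) \<in> G \<and> walk G v es j"

definition reach :: "('v, 'n::finite) cgraph \<Rightarrow> 'v \<Rightarrow> nat ^ 'n \<Rightarrow> 'v \<Rightarrow> bool" where
  "reach G i \<alpha> j \<longleftrightarrow>
     (\<exists>es. walk G i es j \<and> (\<forall>p. count_list (map (\<lambda>(u, c, v). c) es) p = \<alpha> $ p))"

definition hopf_graph :: "('v, 'n::finite) cgraph \<Rightarrow> bool" where
  "hopf_graph G \<longleftrightarrow> (\<forall>i j k (\<alpha> :: 'n mdeg) (\<beta> :: 'n mdeg).
     (reach G i (mvec \<alpha>) j \<and> reach G j (mvec \<beta>) k) \<longleftrightarrow>
     (reach G i (mvec \<alpha>) j \<and> reach G i (mvec (\<alpha> + \<beta>)) k))"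

definition graph_sdse :: "('m, 'n::finite) cgraph \<Rightarrow> ('m, 'n, 'k::field) sdse" where
  "graph_sdse G = linear_sdse (\<lambda>i \<alpha>. {j. reach G i (mvec \<alpha>) j})"


section \<open>The dual pre-Lie algebra\<close>

definition gen_monom ::
  "('m, 'n, 'k::field) sdse \<Rightarrow> ('m \<times> 'n::finite mdeg) multiset \<Rightarrow> (('m \<times> 'n mdeg) forest \<Rightarrow>\<^sub>0 'k)" where
  "gen_monom S m = prod_mset (image_mset (\<lambda>(i, \<alpha>). gen S i \<alpha>) m)"

text \<open>Coefficients in the expansion along the monomials in the generators, respectively along the
  tensor products of two such monomials.\<close>

definition monom_coeff ::
  "('m, 'n, 'k::field) sdse \<Rightarrow> (('m \<times> 'n::finite mdeg) forest \<Rightarrow>\<^sub>0 'k)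
     \<Rightarrow> ('m \<times> 'n mdeg) multiset \<Rightarrow> 'k" where
  "monom_coeff S x m = Poly_Mapping.lookup (THE c. lin_ext (gen_monom S) c = x) m"

definition tensor_coeff ::
  "('m, 'n, 'k::field) sdse \<Rightarrow> (('m \<times> 'n::finite mdeg) forest \<times> ('m \<times> 'n mdeg) forest \<Rightarrow>\<^sub>0 'k)
     \<Rightarrow> ('m \<times> 'n mdeg) multiset \<Rightarrow> ('m \<times> 'n mdeg) multiset \<Rightarrow> 'k" where
  "tensor_coeff S z m m' = Poly_Mapping.lookup
     (THE c. lin_ext (\<lambda>(u, v). tensor (gen_monom S u) (gen_monom S v)) c = z) (m, m')"

text \<open>Functionals on \<open>H_sub S\<close> are extended by \<open>0\<close> to functions on the whole algebra.\<close>

type_synonym ('m, 'n, 'k) functional = "(('m \<times> 'n mdeg) forest \<Rightarrow>\<^sub>0 'k) \<Rightarrow> 'k"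

definition graded_dual ::
  "('m, 'n::finite, 'k::field) sdse \<Rightarrow> ('m, 'n, 'k) functional set" where
  "graded_dual S = {\<phi>.
     (\<forall>x. x \<notin> H_sub S \<longrightarrow> \<phi> x = 0) \<and>
     (\<forall>x\<in>H_sub S. \<forall>y\<in>H_sub S. \<phi> (x + y) = \<phi> x + \<phi> y) \<and>
     (\<forall>c. \<forall>x\<in>H_sub S. \<phi> (pm_scale c x) = c * \<phi> x) \<and>
     (\<exists>A. finite A \<and>
        (\<forall>\<delta>. \<delta> \<notin> A \<longrightarrow> (\<forall>x\<in>H_sub S. (\<forall>F\<in>Poly_Mapping.keys x. forest_deg F = \<delta>) \<longrightarrow> \<phi> x = 0)))}"

text \<open>The graded dual being the enveloping algebra of the pre-Lie algebra, the latter is, as a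
  vector space, the space of primitive elements of the graded dual.\<close>

definition dual_prelie ::
  "('m, 'n::finite, 'k::field) sdse \<Rightarrow> ('m, 'n, 'k) functional set" where
  "dual_prelie S = {\<phi> \<in> graded_dual S.
     \<forall>x\<in>H_sub S. \<forall>y\<in>H_sub S. \<phi> (x * y) = \<phi> x * counit y + counit x * \<phi> y}"

definition dual_gen ::
  "('m, 'n::finite, 'k::field) sdse \<Rightarrow> 'm \<Rightarrow> 'n mdeg \<Rightarrow> ('m, 'n, 'k) functional" where
  "dual_gen S i \<alpha> = (\<lambda>x. if x \<in> H_sub S then monom_coeff S x {#(i, \<alpha>)#} else 0)"

definition struct_const ::
  "('m, 'n::finite, 'k::field) sdse \<Rightarrow> 'm \<Rightarrow> 'n mdeg \<Rightarrow> 'm \<Rightarrow> 'n mdeg \<Rightarrow> 'k" where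
  "struct_const S j \<beta> i \<alpha> =
     tensor_coeff S (coproduct (gen S i (\<alpha> + \<beta>)) - tensor (gen S i (\<alpha> + \<beta>)) 1)
       {#(j, \<beta>)#} {#(i, \<alpha>)#}"

text \<open>The bilinear product with
  \<open>dual_gen S j \<beta> * dual_gen S i \<alpha> = struct_const S j \<beta> i \<alpha> \<cdot> dual_gen S i (\<alpha> + \<beta>)\<close>; the coordinates
  of \<open>\<phi>\<close> along the family \<open>dual_gen S\<close> are its values on the generators.\<close>

definition dual_prod ::
  "('m, 'n::finite, 'k::field) sdse
     \<Rightarrow> ('m, 'n, 'k) functional \<Rightarrow> ('m, 'n, 'k) functional \<Rightarrow> ('m, 'n, 'k) functional" where
  "dual_prod S \<phi> \<psi> =
     (\<Sum>(j, \<beta>)\<in>{(j, \<beta>). \<phi> (gen S j \<beta>) \<noteq> 0}. \<Sum>(i, \<alpha>)\<in>{(i, \<alpha>). \<psi> (gen S i \<alpha>) \<noteq> 0}.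
        fun_scale (\<phi> (gen S j \<beta>) * \<psi> (gen S i \<alpha>) * struct_const S j \<beta> i \<alpha>) (dual_gen S i (\<alpha> + \<beta>)))"

definition left_prelie_algebra ::
  "('a \<Rightarrow> 'k::field) set \<Rightarrow> (('a \<Rightarrow> 'k) \<Rightarrow> ('a \<Rightarrow> 'k) \<Rightarrow> ('a \<Rightarrow> 'k)) \<Rightarrow> bool" where
  "left_prelie_algebra V p \<longleftrightarrow> fn.subspace V \<and>
     (\<forall>x\<in>V. \<forall>y\<in>V. p x y \<in> V) \<and>
     (\<forall>x\<in>V. \<forall>y\<in>V. \<forall>z\<in>V. p (x + y) z = p x z + p y z \<and> p x (y + z) = p x y + p x z) \<and>
     (\<forall>c. \<forall>x\<in>V. \<forall>y\<in>V. p (fun_scale c x) y = fun_scale c (p x y) \<and>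
                          p x (fun_scale c y) = fun_scale c (p x y)) \<and>
     (\<forall>x\<in>V. \<forall>y\<in>V. \<forall>z\<in>V. p (p x y) z - p x (p y z) = p (p y x) z - p y (p x z))"

definition associative_on :: "'a set \<Rightarrow> ('a \<Rightarrow> 'a \<Rightarrow> 'a) \<Rightarrow> bool" where
  "associative_on V p \<longleftrightarrow> (\<forall>x\<in>V. \<forall>y\<in>V. \<forall>z\<in>V. p (p x y) z = p x (p y z))"

definition is_basis :: "('i \<Rightarrow> 'a \<Rightarrow> 'k::field) \<Rightarrow> ('a \<Rightarrow> 'k) set \<Rightarrow> bool" where
  "is_basis b V \<longleftrightarrow> inj b \<and> fn.independent (range b) \<and> fn.span (range b) = V"

end

theory Submission
  imports Defs
begin

text \<open>
The solution of the system is made of ladders: \<open>X\<^sub>i(\<delta>)\<close> is the sum of all ladders with root colour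
\<open>i\<close> and degree \<open>\<delta>\<close> in which a vertex decorated by \<open>(k, \<alpha>)\<close> is followed by a vertex decorated by
\<open>(l, \<gamma>)\<close> only if \<open>l \<in> I k \<alpha>\<close>. In recursive form (\<open>gen_rec\<close>), this says
\<open>X\<^sub>i(\<delta>) = B\<^bsub>i,\<delta>\<^esub>(1) + \<Sum>\<^bsub>\<alpha> + \<beta> = \<delta>\<^esub> \<Sum>\<^bsub>j \<in> I i \<alpha>\<^esub> B\<^bsub>i,\<alpha>\<^esub>(X\<^sub>j(\<beta>))\<close>.

Everything revolves around one combinatorial condition, \<open>compatible\<close>: if \<open>j \<in> I i \<alpha>\<close> then
\<open>I j \<beta> = I i (\<alpha> + \<beta>)\<close>. It is equivalent to the system being Hopf and, the sets \<open>I i \<alpha>\<close> being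
nonempty, to the system being the one of a Hopf graph.

If the system is compatible, induction on the degree and the cocycle property of the graftings give
\<open>\<Delta> X\<^sub>i(\<delta>) = X\<^sub>i(\<delta>) \<otimes> 1 + 1 \<otimes> X\<^sub>i(\<delta>) + \<Sum>\<^bsub>\<alpha> + \<beta> = \<delta>\<^esub> \<Sum>\<^bsub>j \<in> I i \<alpha>\<^esub> X\<^sub>j(\<beta>) \<otimes> X\<^sub>i(\<alpha>)\<close>
(\<open>coproduct_gen\<close>). Hence the subalgebra is stable under the coproduct. As moreover
\<open>\<Delta> m - m \<otimes> 1\<close> only has left factors of smaller degree than the monomial \<open>m\<close>, an induction on the degree
yields stability under the antipode (\<open>compatible_imp_hopf\<close>).

Conversely, let the system be Hopf. Applying the coefficient of the one-vertex tree
\<open>(j, \<beta>)\<close> to the left factor of \<open>\<Delta> X\<^sub>i(\<alpha> + \<gamma> + \<beta>)\<close> gives an element \<open>y\<close> of the subalgebra. A one-vertex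
tree \<open>(i, \<alpha> + \<gamma>)\<close> and a ladder \<open>(i, \<alpha>), (l, \<gamma>)\<close> with \<open>l \<in> I i \<alpha>\<close> have the same coefficient in each
generator, and the elements in which they have the same coefficient form a subalgebra, so that they
have the same coefficient in \<open>y\<close>. For \<open>y\<close>, these coefficients tell whether \<open>j \<in> I i (\<alpha> + \<gamma>)\<close> and whether
\<open>j \<in> I l \<gamma>\<close>; this is compatibility (\<open>hopf_imp_compatible\<close>).

The graph of a compatible system has an edge of colour \<open>p\<close> from \<open>i\<close> to \<open>j\<close> whenever \<open>j \<in> I i \<epsilon>\<^sub>p\<close>, where
\<open>\<epsilon>\<^sub>p\<close> is the unit vector; compatibility and nonemptiness of the sets yield that \<open>I i \<alpha>\<close> consists of the
vertices reached from \<open>i\<close> along \<open>\<alpha>\<close> (\<open>reach_unit_graph\<close>).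

For the dual, the coefficients of an element along the monomials in the generators are its
coefficients at the forests of isolated vertices (\<open>coef_gen_monom\<close>), since the only
isolated vertex in \<open>X\<^sub>i(\<alpha>)\<close> is \<open>(i, \<alpha>)\<close>. A primitive functional is determined by its values on the generators
(\<open>dual_prelie_eqI\<close>), and the formula for the coproduct turns into
\<open>(\<phi> * \<psi>)(X\<^sub>k(\<gamma>)) = \<Sum>\<^bsub>\<alpha> + \<beta> = \<gamma>\<^esub> \<Sum>\<^bsub>j \<in> I k \<alpha>\<^esub> \<phi>(X\<^sub>j(\<beta>)) \<psi>(X\<^sub>k(\<alpha>))\<close> (\<open>dual_prod_gen\<close>), from which bilinearity and
associativity are read off; an associative product is pre-Lie.
\<close>

section \<open>Tensor products and graftings\<close>

abbreviation coef :: "('a \<Rightarrow>\<^sub>0 'k::field) \<Rightarrow> 'a \<Rightarrow> 'k" where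
  "coef \<equiv> Poly_Mapping.lookup"

lemma lookup_tensor: "coef (tensor p q) (F, G) = coef p F * coef q G"
proof -
  have *: "coef (lin_ext (\<lambda>b. Poly_Mapping.single (a, b) 1) q) (F, G) = (if a = F then coef q G else 0)" for a
    by (induction q rule: pm_induct) (auto simp: lin_ext_add lookup_add lookup_single when_def)
  show ?thesis
    unfolding tensor_def
    by (induction p rule: pm_induct) (auto simp: lin_ext_add lookup_add lookup_single when_def * algebra_simps)
qed

lemma tensor_add_right: "tensor p (q + q') = tensor p q + tensor p q'"
  by (rule poly_mapping_eqI) (auto simp: lookup_tensor lookup_add algebra_simps)

lemma tensor_scale_right: "tensor p (pm_scale c q) = pm_scale c (tensor p q)"
  by (rule poly_mapping_eqI) (auto simp: lookup_tensor)

lemma tensor_zero [simp]: "tensor 0 q = 0" "tensor p 0 = 0"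
  by (rule poly_mapping_eqI; auto simp: lookup_tensor)+

lemma tensor_sum_right: "tensor p (sum f A) = (\<Sum>a\<in>A. tensor p (f a))"
  by (induction A rule: infinite_finite_induct) (auto simp: tensor_add_right)

lemma tensor_sum_left: "tensor (sum f A) q = (\<Sum>a\<in>A. tensor (f a) q)"
  by (induction A rule: infinite_finite_induct) (auto simp: tensor_add_left)

lemma tensor_single:
  "tensor (Poly_Mapping.single F a) (Poly_Mapping.single G b) = Poly_Mapping.single (F, G) (a * b)"
  by (rule poly_mapping_eqI) (auto simp: lookup_tensor lookup_single when_def split: if_splits)

lemma tensor_1_1: "tensor 1 1 = (1 :: _ \<Rightarrow>\<^sub>0 'k::field)"
proof -
  have "(0::'a, 0::'b) = 0" by (simp add: zero_prod_def)
  then show ?thesis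
    using tensor_single[of "0::'a" "1::'k" "0::'b" 1] by simp
qed

lemma tensor_mult:
  fixes p p' :: "'a::comm_monoid_add \<Rightarrow>\<^sub>0 'k::field" and q q' :: "'b::comm_monoid_add \<Rightarrow>\<^sub>0 'k"
  shows "tensor p q * tensor p' q' = tensor (p * p') (q * q')"
proof (induction p rule: pm_induct)
  case (add a c p)
  have "tensor (Poly_Mapping.single a c) q * tensor p' q' = tensor (Poly_Mapping.single a c * p') (q * q')"
  proof (induction q rule: pm_induct)
    case (add b d q)
    have "tensor (Poly_Mapping.single a c) (Poly_Mapping.single b d) * tensor p' q'
        = tensor (Poly_Mapping.single a c * p') (Poly_Mapping.single b d * q')"
    proof (induction p' rule: pm_induct)
      case (add a' c' p')
      have "tensor (Poly_Mapping.single a c) (Poly_Mapping.single b d) * tensor (Poly_Mapping.single a' c') q'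
        = tensor (Poly_Mapping.single a c * Poly_Mapping.single a' c') (Poly_Mapping.single b d * q')"
        by (induction q' rule: pm_induct)
          (auto simp: tensor_add_right distrib_left tensor_single mult_single ac_simps)
      then show ?case
        by (simp add: tensor_add_left distrib_left add)
    qed simp
    then show ?case by (simp add: tensor_add_right distrib_right add)
  qed simp
  then show ?case by (simp add: tensor_add_left distrib_right add)
qed simp

lemma lookup_graft:
  "coef (graft d x) {#Node e G#} = (if d = e then coef x G else 0)"
  "(\<And>e G. F \<noteq> {#Node e G#}) \<Longrightarrow> coef (graft d x) F = 0"
  unfolding graft_def
  by (induction x rule: pm_induct) (auto simp: lin_ext_add lookup_add lookup_single when_def)

lemma graft_add: "graft d (x + y) = graft d x + graft d y"
  by (simp add: graft_def lin_ext_add)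

lemma graft_0 [simp]: "graft d 0 = 0"
  by (simp add: graft_def)

lemma graft_scale: "graft d (pm_scale c x) = pm_scale c (graft d x)"
  by (simp add: graft_def lin_ext_scale)

lemma coproduct_add: "coproduct (x + y) = coproduct x + coproduct y"
  by (simp add: coproduct_def lin_ext_add)

lemma coproduct_0 [simp]: "coproduct 0 = 0"
  by (simp add: coproduct_def)

lemma coproduct_scale: "coproduct (pm_scale c x) = pm_scale c (coproduct x)"
  by (simp add: coproduct_def lin_ext_scale)

lemma coproduct_sum: "coproduct (sum f A) = (\<Sum>a\<in>A. coproduct (f a))"
  by (induction A rule: infinite_finite_induct) (auto simp: coproduct_add)

lemma id_tensor_graft_add: "id_tensor_graft d (x + y) = id_tensor_graft d x + id_tensor_graft d y"
  by (simp add: id_tensor_graft_def lin_ext_add)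

lemma id_tensor_graft_0 [simp]: "id_tensor_graft d 0 = 0"
  by (simp add: id_tensor_graft_def)

lemma id_tensor_graft_sum: "id_tensor_graft d (sum f A) = (\<Sum>a\<in>A. id_tensor_graft d (f a))"
  by (induction A rule: infinite_finite_induct) (auto simp: id_tensor_graft_add)

lemma id_tensor_graft_tensor: "id_tensor_graft d (tensor p q) = tensor p (graft d q)"
proof (induction p rule: pm_induct)
  case (add a c p)
  have "id_tensor_graft d (tensor (Poly_Mapping.single a c) q) = tensor (Poly_Mapping.single a c) (graft d q)"
  proof (induction q rule: pm_induct)
    case (add b e q)
    have "id_tensor_graft d (tensor (Poly_Mapping.single a c) (Poly_Mapping.single b e))
        = tensor (Poly_Mapping.single a c) (graft d (Poly_Mapping.single b e))"
      by (rule poly_mapping_eqI)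
        (auto simp: tensor_single id_tensor_graft_def graft_def lookup_tensor lookup_single when_def split: if_splits)
    with add show ?case by (simp add: tensor_add_right id_tensor_graft_add graft_add)
  qed simp
  with add show ?case by (simp add: tensor_add_left id_tensor_graft_add)
qed simp

text \<open>The map \<open>\<phi> \<otimes> Id\<close>, where \<open>\<phi>\<close> is the coefficient of the forest \<open>a\<close>.\<close>

definition slice :: "'a \<Rightarrow> ('a \<times> 'b \<Rightarrow>\<^sub>0 'k::field) \<Rightarrow> ('b \<Rightarrow>\<^sub>0 'k)" where
  "slice a = lin_ext (\<lambda>(F, G). if F = a then Poly_Mapping.single G 1 else 0)"

lemma slice_add: "slice a (x + y) = slice a x + slice a y"
  by (simp add: slice_def lin_ext_add)

lemma slice_0 [simp]: "slice a 0 = 0"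
  by (simp add: slice_def)

lemma slice_scale: "slice a (pm_scale c x) = pm_scale c (slice a x)"
  by (simp add: slice_def lin_ext_scale)

lemma slice_sum: "slice a (sum f A) = (\<Sum>b\<in>A. slice a (f b))"
  by (induction A rule: infinite_finite_induct) (auto simp: slice_add)

lemma lookup_slice: "coef (slice a z) G = coef z (a, G)"
  unfolding slice_def
  by (induction z rule: pm_induct)
    (auto simp: lin_ext_add lookup_add lookup_single when_def split: prod.splits)

lemma slice_tensor: "slice a (tensor p q) = pm_scale (coef p a) q"
  by (rule poly_mapping_eqI) (simp add: lookup_slice lookup_tensor)

lemma slice_id_tensor_graft: "slice a (id_tensor_graft d z) = graft d (slice a z)"
proof (induction z rule: pm_induct)
  case (add p c z)
  obtain F G where p: "p = (F, G)" by (cases p)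
  have "Poly_Mapping.single p c = tensor (Poly_Mapping.single F c) (Poly_Mapping.single G 1)"
    by (simp add: tensor_single p)
  with add show ?case
    by (simp add: id_tensor_graft_add slice_add graft_add id_tensor_graft_tensor slice_tensor graft_scale)
qed simp

lemma lookup_mult_tree:
  fixes x y :: "'d forest \<Rightarrow>\<^sub>0 'k::field"
  shows "coef (x * y) {#t#} = coef x {#t#} * coef y {#} + coef x {#} * coef y {#t#}"
proof (induction x rule: pm_induct)
  case (add a c x)
  have "coef (Poly_Mapping.single a c * y) {#t#} =
    coef (Poly_Mapping.single a c) {#t#} * coef y {#} + coef (Poly_Mapping.single a c) {#} * coef y {#t#}"
    by (induction y rule: pm_induct)
      (auto simp: distrib_left mult_single lookup_add lookup_single when_def union_is_single algebra_simps)
  with add show ?case by (simp add: distrib_right lookup_add algebra_simps)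
qed simp


section \<open>Decompositions of multi-degrees\<close>

text \<open>The ordered decompositions of a degree into two nonzero degrees.\<close>

definition decomp :: "'n::finite mdeg \<Rightarrow> ('n mdeg \<times> 'n mdeg) set" where
  "decomp \<delta> = {(\<alpha>, \<beta>). \<alpha> + \<beta> = \<delta>}"

lemma decomp_iff: "(\<alpha>, \<beta>) \<in> decomp \<delta> \<longleftrightarrow> \<alpha> + \<beta> = \<delta>"
  by (simp add: decomp_def)

lemma finite_mvec_le: "finite {\<alpha> :: 'n::finite mdeg. \<forall>p. mvec \<alpha> $ p \<le> v $ p}"
proof -
  have "mvec ` {\<alpha> :: 'n mdeg. \<forall>p. mvec \<alpha> $ p \<le> v $ p} \<subseteq> vec_lambda ` (PiE UNIV (\<lambda>p. {..v $ p}))"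
  proof (rule image_subsetI)
    fix \<alpha> :: "'n mdeg" assume "\<alpha> \<in> {\<alpha>. \<forall>p. mvec \<alpha> $ p \<le> v $ p}"
    then show "mvec \<alpha> \<in> vec_lambda ` (PiE UNIV (\<lambda>p. {..v $ p}))"
      by (intro image_eqI[of _ _ "\<lambda>p. mvec \<alpha> $ p"]) auto
  qed
  then have "finite (mvec ` {\<alpha> :: 'n mdeg. \<forall>p. mvec \<alpha> $ p \<le> v $ p})"
    by (rule finite_subset) (intro finite_imageI finite_PiE; simp)
  then show ?thesis
    by (rule finite_imageD) (auto simp: inj_on_def mvec_inject)
qed

lemma finite_decomp [simp]: "finite (decomp \<delta>)"
proof -
  let ?A = "{\<alpha>. \<forall>p. mvec \<alpha> $ p \<le> mvec \<delta> $ p}"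
  have "decomp \<delta> \<subseteq> ?A \<times> ?A" by (auto simp: decomp_def mvec_add)
  then show ?thesis by (rule finite_subset) (auto intro: finite_mvec_le)
qed

lemma mdeg_add_cancel [simp]:
  "\<alpha> + \<beta> = \<alpha> + \<gamma> \<longleftrightarrow> \<beta> = \<gamma>" "\<beta> + \<alpha> = \<gamma> + \<alpha> \<longleftrightarrow> \<beta> = \<gamma>" for \<alpha> \<beta> \<gamma> :: "'n::finite mdeg"
  by (simp_all add: mvec_inject[symmetric] mvec_add)

text \<open>The total degree, on which the inductions run.\<close>

definition msize :: "'n::finite mdeg \<Rightarrow> nat" where
  "msize \<alpha> = (\<Sum>p\<in>UNIV. mvec \<alpha> $ p)"

lemma msize_pos: "0 < msize \<alpha>"
proof (rule ccontr)
  assume "\<not> 0 < msize \<alpha>"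
  then have "mvec \<alpha> = 0" by (simp add: msize_def vec_eq_iff)
  then show False using mvec[of \<alpha>] by simp
qed

lemma msize_add [simp]: "msize (\<alpha> + \<beta>) = msize \<alpha> + msize \<beta>"
  by (simp add: msize_def mvec_add sum.distrib)

text \<open>Both sides sum over the decompositions \<open>\<delta> = \<alpha> + \<gamma> + \<epsilon>\<close>.\<close>

lemma sum_decomp_assoc:
  "(\<Sum>(\<alpha>, \<beta>)\<in>decomp \<delta>. \<Sum>(\<gamma>, \<epsilon>)\<in>decomp \<beta>. f \<alpha> \<gamma> \<epsilon>)
     = (\<Sum>(\<zeta>, \<epsilon>)\<in>decomp \<delta>. \<Sum>(\<alpha>, \<gamma>)\<in>decomp \<zeta>. f \<alpha> \<gamma> \<epsilon>)"
proof -
  have "(\<Sum>p\<in>decomp \<delta>. \<Sum>q\<in>decomp (snd p). f (fst p) (fst q) (snd q))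
     = (\<Sum>(p, q)\<in>(SIGMA p:decomp \<delta>. decomp (snd p)). f (fst p) (fst q) (snd q))"
    by (rule sum.Sigma) auto
  also have "\<dots> = (\<Sum>(p, q)\<in>(SIGMA p:decomp \<delta>. decomp (fst p)). f (fst q) (snd q) (snd p))"
    by (rule sum.reindex_bij_witness[where
          i = "\<lambda>((\<zeta>, \<epsilon>), (\<alpha>, \<gamma>)). ((\<alpha>, \<gamma> + \<epsilon>), (\<gamma>, \<epsilon>))" and
          j = "\<lambda>((\<alpha>, \<beta>), (\<gamma>, \<epsilon>)). ((\<alpha> + \<gamma>, \<epsilon>), (\<alpha>, \<gamma>))"])
      (auto simp: decomp_def add.assoc)
  also have "\<dots> = (\<Sum>p\<in>decomp \<delta>. \<Sum>q\<in>decomp (fst p). f (fst q) (snd q) (snd p))"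
    by (rule sum.Sigma[symmetric]) auto
  finally show ?thesis by (simp add: case_prod_beta)
qed

section \<open>The solution of a linear system\<close>

text \<open>The generators of the subalgebra.\<close>

abbreviation X ::
  "('m \<Rightarrow> 'n::finite mdeg \<Rightarrow> 'm set) \<Rightarrow> 'm \<Rightarrow> 'n mdeg \<Rightarrow> (('m \<times> 'n mdeg) forest \<Rightarrow>\<^sub>0 'k::field)" where
  "X I \<equiv> gen (linear_sdse I)"

text \<open>The tree with one vertex.\<close>

definition leaf :: "'d \<Rightarrow> 'd rtree" where
  "leaf d = Node d {#}"

lemma solution_tree:
  "solution (linear_sdse I) i {#Node (k, \<alpha>) G#} =
     (if k = i then series_one G + (\<Sum>j\<in>I i \<alpha>. solution (linear_sdse I) j G) else (0::'k::field))"
  by (subst solution_eq) (rule linear_sdse_tree)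

lemma solution_not_tree:
  "(\<And>d G. F \<noteq> {#Node d G#}) \<Longrightarrow> solution (linear_sdse I) i F = (0::'k::field)"
  by (subst solution_eq) (rule linear_sdse_not_tree)

lemma forest_deg_tree [simp]: "forest_deg {#Node (i, \<alpha>) G#} = mvec \<alpha> + forest_deg G"
  by (simp add: forest_deg_def)

lemma forest_deg_empty [simp]: "forest_deg {#} = 0"
  by (simp add: forest_deg_def)

lemma mvec_neq_0 [simp]: "mvec \<alpha> \<noteq> 0" "0 \<noteq> mvec \<alpha>"
  using mvec[of \<alpha>] by auto

lemma forest_deg_eq_0_iff [simp]: "forest_deg F = 0 \<longleftrightarrow> F = {#}"
proof (cases F)
  case (add t G)
  obtain d H where "t = Node d H" by (cases t)
  then show ?thesis using add by (simp add: forest_deg_def mdeg_add_nonzero add.assoc)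
qed simp

lemma finite_support_solution:
  fixes I :: "'m::finite \<Rightarrow> 'n::finite mdeg \<Rightarrow> 'm set"
  shows "finite {F. forest_deg F = v \<and> solution (linear_sdse I) i F \<noteq> (0::'k::field)}"
proof (induction "\<Sum>p\<in>UNIV. v $ p" arbitrary: v i rule: less_induct)
  case less
  let ?A = "{\<alpha> :: 'n mdeg. \<forall>p. mvec \<alpha> $ p \<le> v $ p}"
  let ?T = "\<lambda>\<alpha>. (\<Union>j. {G. forest_deg G = v - mvec \<alpha> \<and> solution (linear_sdse I) j G \<noteq> (0::'k)})"
  have "finite (?T \<alpha>)" if "\<alpha> \<in> ?A" for \<alpha>
  proof (rule finite_UN_I)
    fix j
    have "(\<Sum>p\<in>UNIV. v $ p) = (\<Sum>p\<in>UNIV. (v - mvec \<alpha>) $ p) + msize \<alpha>"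
      using that by (simp add: msize_def flip: sum.distrib)
    then show "finite {G. forest_deg G = v - mvec \<alpha> \<and> solution (linear_sdse I) j G \<noteq> (0::'k)}"
      using msize_pos[of \<alpha>] by (intro less) simp
  qed simp
  then have fin: "finite (\<Union>\<alpha>\<in>?A. (\<lambda>G. {#Node (i, \<alpha>) G#}) ` ({{#}} \<union> ?T \<alpha>))"
    by (intro finite_UN_I finite_mvec_le) auto
  show ?case
  proof (rule finite_subset[OF _ fin], rule subsetI)
    fix F assume "F \<in> {F. forest_deg F = v \<and> solution (linear_sdse I) i F \<noteq> (0::'k)}"
    then have F: "forest_deg F = v" "solution (linear_sdse I) i F \<noteq> (0::'k)" by auto
    obtain k \<alpha> G where FG: "F = {#Node (k, \<alpha>) G#}"
      using F(2) solution_not_tree[of F I i] by (metis surj_pair)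
    with F have k: "k = i" by (auto simp: solution_tree split: if_splits)
    have v: "v = mvec \<alpha> + forest_deg G" using F(1) FG by simp
    have "G = {#} \<or> (\<exists>j. solution (linear_sdse I) j G \<noteq> (0::'k))"
    proof (rule ccontr)
      assume "\<not> ?thesis"
      then show False using F(2) by (simp add: FG k solution_tree series_one_def)
    qed
    then have "G \<in> {{#}} \<union> ?T \<alpha>" using v by auto
    moreover have "\<alpha> \<in> ?A" using v by auto
    ultimately show "F \<in> (\<Union>\<alpha>\<in>?A. (\<lambda>G. {#Node (i, \<alpha>) G#}) ` ({{#}} \<union> ?T \<alpha>))"
      unfolding FG k by blast
  qed
qed

text \<open>The finiteness of the support makes the homogeneous components of the solution genuine elements of
  the algebra of forests.\<close>

lemma coef_gen:
  fixes I :: "'m::finite \<Rightarrow> 'n::finite mdeg \<Rightarrow> 'm set"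
  shows "coef (X I i \<delta>) F = (if forest_deg F = mvec \<delta> then solution (linear_sdse I) i F else (0::'k::field))"
proof -
  let ?f = "\<lambda>F. if forest_deg F = mvec \<delta> then solution (linear_sdse I) i F else (0::'k)"
  have "{F. ?f F \<noteq> 0} = {F. forest_deg F = mvec \<delta> \<and> solution (linear_sdse I) i F \<noteq> (0::'k)}"
    by auto
  then have "finite {F. ?f F \<noteq> 0}"
    using finite_support_solution[of "mvec \<delta>" I i, where 'k = 'k] by simp
  then have "Poly_Mapping.lookup (Abs_poly_mapping ?f) = ?f"
    by (intro Abs_poly_mapping_inverse) simp
  then show ?thesis by (simp add: gen_def hom_component_def)
qed

lemma coef_gen_empty [simp]:
  fixes I :: "'m::finite \<Rightarrow> 'n::finite mdeg \<Rightarrow> 'm set"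
  shows "coef (X I i \<delta>) {#} = 0"
  by (simp add: coef_gen)

lemma coef_one: "coef 1 F = (if F = {#} then 1 else 0)"
  by (simp add: lookup_one when_def)

text \<open>The homogeneous component of degree \<open>\<delta>\<close> of the system.\<close>

lemma gen_rec:
  fixes I :: "'m::finite \<Rightarrow> 'n::finite mdeg \<Rightarrow> 'm set"
  shows "(X I i \<delta> :: _ \<Rightarrow>\<^sub>0 'k::field) =
    graft (i, \<delta>) 1 + (\<Sum>(\<alpha>, \<beta>)\<in>decomp \<delta>. \<Sum>j\<in>I i \<alpha>. graft (i, \<alpha>) (X I j \<beta>))"
proof (rule poly_mapping_eqI)
  fix F
  show "coef (X I i \<delta>) F =
    coef (graft (i, \<delta>) (1 :: _ \<Rightarrow>\<^sub>0 'k) + (\<Sum>(\<alpha>, \<beta>)\<in>decomp \<delta>. \<Sum>j\<in>I i \<alpha>. graft (i, \<alpha>) (X I j \<beta>))) F"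
  proof (cases "\<exists>e G. F = {#Node e G#}")
    case False
    then have "\<And>e G. F \<noteq> {#Node e G#}" by blast
    then show ?thesis
      by (simp add: coef_gen solution_not_tree lookup_add lookup_sum lookup_graft(2) case_prod_beta)
  next
    case True
    then obtain k \<alpha> G where F: "F = {#Node (k, \<alpha>) G#}" by auto
    show ?thesis
    proof (cases "k = i \<and> G \<noteq> {#}")
      case False
      then show ?thesis
        by (auto simp: F coef_gen solution_tree solution_not_tree series_one_def coef_one mvec_inject
            lookup_add lookup_sum lookup_graft case_prod_beta cong: if_cong)
    next
      case True
      then have k: "k = i" and G: "G \<noteq> {#}" by auto
      \<comment> \<open>At \<open>F\<close>, only the decomposition into \<open>\<alpha>\<close> and the degree of \<open>G\<close> contributes.\<close>
      define \<beta> where "\<beta> = Abs_mdeg (forest_deg G)"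
      have \<beta>: "forest_deg G = mvec \<beta>" using G by (simp add: \<beta>_def Abs_mdeg_inverse)
      have "(\<Sum>p\<in>decomp \<delta>. \<Sum>j\<in>I i (fst p). coef (graft (i, fst p) (X I j (snd p) :: _ \<Rightarrow>\<^sub>0 'k)) F)
        = (\<Sum>p\<in>decomp \<delta>. if p = (\<alpha>, \<beta>) then (\<Sum>j\<in>I i \<alpha>. solution (linear_sdse I) j G) else 0)"
      proof (rule sum.cong[OF refl])
        fix p assume "p \<in> decomp \<delta>"
        then show "(\<Sum>j\<in>I i (fst p). coef (graft (i, fst p) (X I j (snd p) :: _ \<Rightarrow>\<^sub>0 'k)) F)
          = (if p = (\<alpha>, \<beta>) then (\<Sum>j\<in>I i \<alpha>. solution (linear_sdse I) j G) else 0)"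
          by (cases p; cases "fst p = \<alpha>") (auto simp: F k lookup_graft coef_gen \<beta> mvec_inject)
      qed
      then show ?thesis
        using G
        by (simp add: F k coef_gen lookup_add lookup_sum lookup_graft coef_one \<beta> solution_tree
            series_one_def case_prod_beta decomp_iff mvec_inject flip: mvec_add)
    qed
  qed
qed


section \<open>The coproduct of a compatible system\<close>

text \<open>The combinatorial form of the Hopf condition.\<close>

definition compatible :: "('m \<Rightarrow> 'n::finite mdeg \<Rightarrow> 'm set) \<Rightarrow> bool" where
  "compatible I \<longleftrightarrow> (\<forall>i \<alpha> j \<beta>. j \<in> I i \<alpha> \<longrightarrow> I j \<beta> = I i (\<alpha> + \<beta>))"

lemma coproduct_gen:
  fixes I :: "'m::finite \<Rightarrow> 'n::finite mdeg \<Rightarrow> 'm set"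
  assumes I: "compatible I"
  shows "coproduct (X I i \<delta> :: _ \<Rightarrow>\<^sub>0 'k::field) =
    tensor (X I i \<delta>) 1 + tensor 1 (X I i \<delta>)
      + (\<Sum>(\<alpha>, \<beta>)\<in>decomp \<delta>. \<Sum>j\<in>I i \<alpha>. tensor (X I j \<beta>) (X I i \<alpha>))"
proof (induction "msize \<delta>" arbitrary: i \<delta> rule: less_induct)
  case less
  let ?X = "X I :: 'm \<Rightarrow> 'n mdeg \<Rightarrow> _ \<Rightarrow>\<^sub>0 'k"
  let ?g = "\<lambda>\<alpha> \<gamma>. \<Sum>j\<in>I i \<alpha>. graft (i, \<alpha>) (?X j \<gamma>)"
  let ?f = "\<lambda>\<alpha> \<gamma> \<epsilon>. \<Sum>k\<in>I i (\<alpha> + \<gamma>). tensor (?X k \<epsilon>) (?g \<alpha> \<gamma>)"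
  have rec: "?X i \<zeta> = graft (i, \<zeta>) 1 + (\<Sum>(\<alpha>, \<beta>)\<in>decomp \<zeta>. ?g \<alpha> \<beta>)" for \<zeta>
    by (rule gen_rec)
  \<comment> \<open>The induction hypothesis applies to \<open>X I j \<beta>\<close>; compatibility makes the set of the \<open>k\<close>
    in its last sum independent of \<open>j\<close>.\<close>
  have inner: "(\<Sum>j\<in>I i \<alpha>. id_tensor_graft (i, \<alpha>) (coproduct (?X j \<beta>)))
     = (\<Sum>j\<in>I i \<alpha>. tensor (?X j \<beta>) (graft (i, \<alpha>) 1)) + tensor 1 (?g \<alpha> \<beta>)
        + (\<Sum>(\<gamma>, \<epsilon>)\<in>decomp \<beta>. ?f \<alpha> \<gamma> \<epsilon>)" if "(\<alpha>, \<beta>) \<in> decomp \<delta>" for \<alpha> \<beta>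
  proof -
    have "msize \<beta> < msize \<delta>"
      using that msize_pos[of \<alpha>] by (auto simp: decomp_def)
    then have "(\<Sum>j\<in>I i \<alpha>. id_tensor_graft (i, \<alpha>) (coproduct (?X j \<beta>)))
      = (\<Sum>j\<in>I i \<alpha>. tensor (?X j \<beta>) (graft (i, \<alpha>) 1) + tensor 1 (graft (i, \<alpha>) (?X j \<beta>))
         + (\<Sum>(\<gamma>, \<epsilon>)\<in>decomp \<beta>. \<Sum>k\<in>I j \<gamma>. tensor (?X k \<epsilon>) (graft (i, \<alpha>) (?X j \<gamma>))))"
      by (simp add: less id_tensor_graft_add id_tensor_graft_sum id_tensor_graft_tensor case_prod_beta)
    also have "\<dots> = (\<Sum>j\<in>I i \<alpha>. tensor (?X j \<beta>) (graft (i, \<alpha>) 1)) + tensor 1 (?g \<alpha> \<beta>)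
        + (\<Sum>j\<in>I i \<alpha>. \<Sum>(\<gamma>, \<epsilon>)\<in>decomp \<beta>. \<Sum>k\<in>I i (\<alpha> + \<gamma>). tensor (?X k \<epsilon>) (graft (i, \<alpha>) (?X j \<gamma>)))"
      using I by (simp add: sum.distrib tensor_sum_right compatible_def cong: sum.cong)
    also have "(\<Sum>j\<in>I i \<alpha>. \<Sum>(\<gamma>, \<epsilon>)\<in>decomp \<beta>. \<Sum>k\<in>I i (\<alpha> + \<gamma>). tensor (?X k \<epsilon>) (graft (i, \<alpha>) (?X j \<gamma>)))
      = (\<Sum>(\<gamma>, \<epsilon>)\<in>decomp \<beta>. ?f \<alpha> \<gamma> \<epsilon>)"
      unfolding case_prod_beta
      by (rule trans[OF sum.swap], rule sum.cong[OF refl], rule trans[OF sum.swap]) (simp add: tensor_sum_right)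
    finally show ?thesis .
  qed
  have "(\<Sum>(\<alpha>, \<beta>)\<in>decomp \<delta>. \<Sum>(\<gamma>, \<epsilon>)\<in>decomp \<beta>. ?f \<alpha> \<gamma> \<epsilon>)
      = (\<Sum>(\<zeta>, \<epsilon>)\<in>decomp \<delta>. \<Sum>(\<alpha>, \<gamma>)\<in>decomp \<zeta>. ?f \<alpha> \<gamma> \<epsilon>)"
    by (rule sum_decomp_assoc)
  also have "\<dots> = (\<Sum>(\<zeta>, \<epsilon>)\<in>decomp \<delta>. \<Sum>k\<in>I i \<zeta>. tensor (?X k \<epsilon>) (\<Sum>(\<alpha>, \<gamma>)\<in>decomp \<zeta>. ?g \<alpha> \<gamma>))"
  proof (intro sum.cong refl, clarify)
    fix \<zeta> \<epsilon>
    have "(\<Sum>(\<alpha>, \<gamma>)\<in>decomp \<zeta>. ?f \<alpha> \<gamma> \<epsilon>) = (\<Sum>p\<in>decomp \<zeta>. \<Sum>k\<in>I i \<zeta>. tensor (?X k \<epsilon>) (?g (fst p) (snd p)))"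
      by (rule sum.cong) (auto simp: decomp_def)
    also have "\<dots> = (\<Sum>k\<in>I i \<zeta>. tensor (?X k \<epsilon>) (\<Sum>(\<alpha>, \<gamma>)\<in>decomp \<zeta>. ?g \<alpha> \<gamma>))"
      by (subst sum.swap) (simp add: tensor_sum_right case_prod_beta)
    finally show "(\<Sum>(\<alpha>, \<gamma>)\<in>decomp \<zeta>. ?f \<alpha> \<gamma> \<epsilon>)
      = (\<Sum>k\<in>I i \<zeta>. tensor (?X k \<epsilon>) (\<Sum>(\<alpha>, \<gamma>)\<in>decomp \<zeta>. ?g \<alpha> \<gamma>))" .
  qed
  finally have assoc: "(\<Sum>(\<alpha>, \<beta>)\<in>decomp \<delta>. \<Sum>(\<gamma>, \<epsilon>)\<in>decomp \<beta>. ?f \<alpha> \<gamma> \<epsilon>)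
      = (\<Sum>(\<zeta>, \<epsilon>)\<in>decomp \<delta>. \<Sum>k\<in>I i \<zeta>. tensor (?X k \<epsilon>) (\<Sum>(\<alpha>, \<gamma>)\<in>decomp \<zeta>. ?g \<alpha> \<gamma>))" .
  have "coproduct (?X i \<delta>) = coproduct (graft (i, \<delta>) 1 + (\<Sum>(\<alpha>, \<beta>)\<in>decomp \<delta>. ?g \<alpha> \<beta>))"
    by (simp only: rec[of \<delta>])
  also have "\<dots> = tensor (graft (i, \<delta>) 1) 1 + tensor 1 (graft (i, \<delta>) 1)
      + (\<Sum>(\<alpha>, \<beta>)\<in>decomp \<delta>. (\<Sum>j\<in>I i \<alpha>. tensor (graft (i, \<alpha>) (?X j \<beta>)) 1)
          + (\<Sum>j\<in>I i \<alpha>. id_tensor_graft (i, \<alpha>) (coproduct (?X j \<beta>))))"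
    by (simp add: coproduct_add coproduct_sum coproduct_graft coproduct_1 case_prod_beta sum.distrib
        id_tensor_graft_tensor flip: tensor_1_1)
  also have "(\<Sum>(\<alpha>, \<beta>)\<in>decomp \<delta>. (\<Sum>j\<in>I i \<alpha>. tensor (graft (i, \<alpha>) (?X j \<beta>)) 1)
          + (\<Sum>j\<in>I i \<alpha>. id_tensor_graft (i, \<alpha>) (coproduct (?X j \<beta>))))
    = (\<Sum>(\<alpha>, \<beta>)\<in>decomp \<delta>. tensor (?g \<alpha> \<beta>) 1
         + ((\<Sum>j\<in>I i \<alpha>. tensor (?X j \<beta>) (graft (i, \<alpha>) 1)) + tensor 1 (?g \<alpha> \<beta>)
        + (\<Sum>(\<gamma>, \<epsilon>)\<in>decomp \<beta>. ?f \<alpha> \<gamma> \<epsilon>)))"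
    by (rule sum.cong) (auto simp: inner tensor_sum_left)
  also have "\<dots> = tensor (\<Sum>(\<alpha>, \<beta>)\<in>decomp \<delta>. ?g \<alpha> \<beta>) 1 + tensor 1 (\<Sum>(\<alpha>, \<beta>)\<in>decomp \<delta>. ?g \<alpha> \<beta>)
     + (\<Sum>(\<alpha>, \<beta>)\<in>decomp \<delta>. \<Sum>j\<in>I i \<alpha>. tensor (?X j \<beta>) (graft (i, \<alpha>) 1))
     + (\<Sum>(\<alpha>, \<beta>)\<in>decomp \<delta>. \<Sum>(\<gamma>, \<epsilon>)\<in>decomp \<beta>. ?f \<alpha> \<gamma> \<epsilon>)"
    unfolding tensor_sum_right tensor_sum_left case_prod_beta sum.distrib by (simp only: ac_simps)
  also have "\<dots> = tensor (\<Sum>(\<alpha>, \<beta>)\<in>decomp \<delta>. ?g \<alpha> \<beta>) 1 + tensor 1 (\<Sum>(\<alpha>, \<beta>)\<in>decomp \<delta>. ?g \<alpha> \<beta>)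
     + (\<Sum>(\<alpha>, \<beta>)\<in>decomp \<delta>. \<Sum>j\<in>I i \<alpha>. tensor (?X j \<beta>) (?X i \<alpha>))"
    unfolding assoc rec[of "fst _"] case_prod_beta tensor_add_right sum.distrib by (simp only: ac_simps)
  finally show ?case
    by (simp only: rec[of \<delta>] tensor_add_left tensor_add_right ac_simps)
qed

section \<open>A Hopf system is compatible\<close>

lemma subalgebra_H_sub: "subalgebra (H_sub S)"
  unfolding H_sub_def
proof (rule hull_in)
  fix \<A> :: "_ set set"
  assume "Ball \<A> subalgebra"
  then show "subalgebra (\<Inter>\<A>)"
    unfolding subalgebra_def by (auto intro: pm.subspace_Inter)
qed

lemma gen_in_H_sub: "gen S i \<alpha> \<in> H_sub S"
  unfolding H_sub_def by (rule hull_inc) auto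

lemma slice_tensor_sub:
  assumes "pm.subspace B" "z \<in> tensor_sub A B"
  shows "slice a z \<in> B"
  using assms(2) unfolding tensor_sub_def
proof (induction rule: pm.span_induct)
  case base
  show ?case
    using assms(1) by (auto simp: pm.subspace_def slice_add slice_scale)
next
  case (step z)
  then show ?case
    using assms(1) by (auto simp: slice_tensor pm.subspace_scale)
qed

lemma slice_coproduct_graft:
  fixes x :: "'d forest \<Rightarrow>\<^sub>0 'k::field"
  shows "slice a (coproduct (graft d x)) = pm_scale (coef (graft d x) a) 1 + graft d (slice a (coproduct x))"
  by (simp add: coproduct_graft slice_add slice_tensor slice_id_tensor_graft)

lemma leaf_inject [simp]: "leaf d = leaf e \<longleftrightarrow> d = e"
  by (simp add: leaf_def)

lemma forest_deg_leaf [simp]: "forest_deg {#leaf (i, \<alpha>)#} = mvec \<alpha>"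
  by (simp add: leaf_def)

lemma solution_leaf [simp]:
  "solution (linear_sdse I) i {#leaf (j, \<beta>)#} = (if i = j then 1 else (0::'k::field))"
  by (auto simp: leaf_def solution_tree solution_not_tree series_one_def)

lemma coef_gen_leaf:
  fixes I :: "'m::finite \<Rightarrow> 'n::finite mdeg \<Rightarrow> 'm set"
  shows "coef (X I i \<delta>) {#leaf (j, \<beta>)#} = (if i = j \<and> \<delta> = \<beta> then 1 else (0::'k::field))"
  by (auto simp: coef_gen mvec_inject)

text \<open>The slice of the coproduct of a generator at the left tensor factor \<open>leaf (j, \<beta>)\<close> is the sum
  of the (possibly empty) ladders that become a summand of the generator by grafting this leaf on their
  top. It satisfies the recursion of the generators, with another inhomogeneous term.\<close>

lemma slice_coproduct_gen:
  fixes I :: "'m::finite \<Rightarrow> 'n::finite mdeg \<Rightarrow> 'm set" and j :: 'm and \<beta> :: "'n mdeg"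
  defines "s \<equiv> \<lambda>i \<delta>. slice {#leaf (j, \<beta>)#} (coproduct (X I i \<delta> :: _ \<Rightarrow>\<^sub>0 'k::field))"
  shows "s i \<delta> = pm_scale (if i = j \<and> \<delta> = \<beta> then 1 else 0) 1
           + (\<Sum>(\<alpha>, \<gamma>)\<in>decomp \<delta>. \<Sum>k\<in>I i \<alpha>. graft (i, \<alpha>) (s k \<gamma>))"
proof -
  let ?a = "{#leaf (j, \<beta>)#}"
  let ?X = "X I :: 'm \<Rightarrow> 'n mdeg \<Rightarrow> _ \<Rightarrow>\<^sub>0 'k"
  have "slice ?a (coproduct 1) = (0 :: _ \<Rightarrow>\<^sub>0 'k)"
    by (simp add: coproduct_1 slice_tensor coef_one flip: tensor_1_1)
  then have "s i \<delta> = pm_scale (coef (graft (i, \<delta>) 1) ?a) 1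
      + (\<Sum>(\<alpha>, \<gamma>)\<in>decomp \<delta>. \<Sum>k\<in>I i \<alpha>. pm_scale (coef (graft (i, \<alpha>) (?X k \<gamma>)) ?a) 1 + graft (i, \<alpha>) (s k \<gamma>))"
    unfolding s_def
    by (subst gen_rec) (simp add: coproduct_add coproduct_sum slice_add slice_sum slice_coproduct_graft case_prod_beta)
  also have "\<dots> = pm_scale (if i = j \<and> \<delta> = \<beta> then 1 else 0) 1
      + (\<Sum>(\<alpha>, \<gamma>)\<in>decomp \<delta>. \<Sum>k\<in>I i \<alpha>. graft (i, \<alpha>) (s k \<gamma>))"
    by (simp add: leaf_def lookup_graft coef_one cong: if_cong)
  finally show ?thesis .
qed

lemma coef_slice_empty:
  fixes I :: "'m::finite \<Rightarrow> 'n::finite mdeg \<Rightarrow> 'm set"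
  shows "coef (slice {#leaf (j, \<beta>)#} (coproduct (X I i \<delta>))) {#}
    = (if i = j \<and> \<delta> = \<beta> then 1 else (0::'k::field))"
  by (subst slice_coproduct_gen)
    (simp add: lookup_add lookup_sum lookup_graft(2) coef_one case_prod_beta)

lemma coef_slice_tree:
  fixes I :: "'m::finite \<Rightarrow> 'n::finite mdeg \<Rightarrow> 'm set"
  shows "coef (slice {#leaf (j, \<beta>)#} (coproduct (X I i (\<alpha> + \<gamma>)))) {#Node (l, \<alpha>) G#}
    = (if l = i then \<Sum>k\<in>I i \<alpha>. coef (slice {#leaf (j, \<beta>)#} (coproduct (X I k \<gamma>))) G else (0::'k::field))"
    (is "?l = (if l = i then ?r else 0)")
proof -
  let ?s = "\<lambda>i \<delta>. slice {#leaf (j, \<beta>)#} (coproduct (X I i \<delta> :: _ \<Rightarrow>\<^sub>0 'k))"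
  have "?l = (\<Sum>p\<in>decomp (\<alpha> + \<gamma>). \<Sum>k\<in>I i (fst p). coef (graft (i, fst p) (?s k (snd p))) {#Node (l, \<alpha>) G#})"
    by (subst slice_coproduct_gen) (simp add: lookup_add lookup_sum coef_one case_prod_beta)
  also have "\<dots> = (\<Sum>p\<in>decomp (\<alpha> + \<gamma>). if p = (\<alpha>, \<gamma>) then (if l = i then ?r else 0) else 0)"
  proof (rule sum.cong[OF refl])
    fix p assume "p \<in> decomp (\<alpha> + \<gamma>)"
    then show "(\<Sum>k\<in>I i (fst p). coef (graft (i, fst p) (?s k (snd p))) {#Node (l, \<alpha>) G#})
      = (if p = (\<alpha>, \<gamma>) then (if l = i then ?r else 0) else 0)"
      by (cases p; cases "fst p = \<alpha>") (auto simp: lookup_graft decomp_def)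
  qed
  also have "\<dots> = (if l = i then ?r else 0)"
    by (simp add: decomp_iff)
  finally show ?thesis .
qed

text \<open>The leaf and the ladder with two vertices have coefficient \<open>1\<close> in the generator \<open>X I i (\<alpha> + \<gamma>)\<close> and
  \<open>0\<close> in the others, so that elements of \<open>H_sub\<close> cannot tell them apart.\<close>

lemma coef_H_sub_ladder:
  fixes I :: "'m::finite \<Rightarrow> 'n::finite mdeg \<Rightarrow> 'm set"
  assumes l: "l \<in> I i \<alpha>" and y: "y \<in> H_sub (linear_sdse I :: ('m, 'n, 'k::field) sdse)"
  shows "coef y {#leaf (i, \<alpha> + \<gamma>)#} = coef y {#Node (i, \<alpha>) {#leaf (l, \<gamma>)#}#}"
proof -
  let ?B = "{y :: _ \<Rightarrow>\<^sub>0 'k. coef y {#leaf (i, \<alpha> + \<gamma>)#} = coef y {#Node (i, \<alpha>) {#leaf (l, \<gamma>)#}#}}"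
  have "subalgebra ?B"
    by (auto simp: subalgebra_def pm.subspace_def lookup_add lookup_mult_tree coef_one)
  moreover have "X I k \<delta> \<in> ?B" for k \<delta>
    using l by (auto simp: coef_gen solution_tree series_one_def mvec_inject mvec_add)
  ultimately have "H_sub (linear_sdse I) \<subseteq> ?B"
    unfolding H_sub_def by (intro hull_minimal) auto
  with y show ?thesis by auto
qed

lemma hopf_imp_compatible:
  fixes I :: "'m::finite \<Rightarrow> 'n::finite mdeg \<Rightarrow> 'm set"
  assumes H: "hopf_sdse (linear_sdse I :: ('m, 'n, 'k::field) sdse)"
  shows "compatible I"
proof -
  have "j \<in> I l \<gamma> \<longleftrightarrow> j \<in> I i (\<alpha> + \<gamma>)" if l: "l \<in> I i \<alpha>" for i \<alpha> l \<gamma> j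
  proof -
    \<comment> \<open>The degree of the leaf that is cut off is irrelevant.\<close>
    define \<beta> :: "'n mdeg" where "\<beta> = \<gamma>"
    let ?s = "\<lambda>i \<delta>. slice {#leaf (j, \<beta>)#} (coproduct (X I i \<delta> :: _ \<Rightarrow>\<^sub>0 'k))"
    let ?y = "?s i (\<alpha> + \<gamma> + \<beta>)"
    let ?A = "H_sub (linear_sdse I :: ('m, 'n, 'k) sdse)"
    have "coproduct (X I i (\<alpha> + \<gamma> + \<beta>)) \<in> tensor_sub ?A ?A"
      using H gen_in_H_sub[of "linear_sdse I"] unfolding hopf_sdse_def hopf_subalgebra_def by blast
    then have "?y \<in> ?A"
      using subalgebra_H_sub by (intro slice_tensor_sub) (auto simp: subalgebra_def)
    then have "coef ?y {#leaf (i, \<alpha> + \<gamma>)#} = coef ?y {#Node (i, \<alpha>) {#leaf (l, \<gamma>)#}#}"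
      by (rule coef_H_sub_ladder[where I = I, OF l])
    moreover have leaf: "coef (?s k (\<delta> + \<beta>)) {#leaf (m, \<delta>)#} = (if m = k \<and> j \<in> I m \<delta> then 1 else 0)" for k m \<delta>
      by (simp add: leaf_def[of "(m, \<delta>)"] coef_slice_tree coef_slice_empty)
    moreover have "coef ?y {#Node (i, \<alpha>) {#leaf (l, \<gamma>)#}#} = (if j \<in> I l \<gamma> then 1 else 0)"
    proof -
      have "coef ?y {#Node (i, \<alpha>) {#leaf (l, \<gamma>)#}#} = (\<Sum>k\<in>I i \<alpha>. coef (?s k (\<gamma> + \<beta>)) {#leaf (l, \<gamma>)#})"
        unfolding add.assoc coef_slice_tree by simp
      also have "\<dots> = (\<Sum>k\<in>I i \<alpha>. if k = l then (if j \<in> I l \<gamma> then 1 else 0) else 0)"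
        unfolding leaf by (rule sum.cong) auto
      finally show ?thesis using l by simp
    qed
    ultimately show ?thesis by (simp split: if_splits)
  qed
  then show ?thesis by (auto simp: compatible_def)
qed


section \<open>Monomials in the generators\<close>

lemma gen_monom_simps [simp]:
  "gen_monom S {#} = 1"
  "gen_monom S (m + m') = gen_monom S m * gen_monom S m'"
  "gen_monom S (add_mset (i, \<alpha>) m) = gen S i \<alpha> * gen_monom S m"
  by (simp_all add: gen_monom_def)

lemma subspace_range_lin_ext: "pm.subspace (range (lin_ext f))"
  unfolding pm.subspace_def
proof (intro conjI ballI allI)
  show "0 \<in> range (lin_ext f)" by (rule range_eqI[of _ _ 0]) simp
next
  fix x y assume "x \<in> range (lin_ext f)" "y \<in> range (lin_ext f)"
  then show "x + y \<in> range (lin_ext f)" by (auto simp flip: lin_ext_add)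
next
  fix a x assume "x \<in> range (lin_ext f)"
  then show "pm_scale a x \<in> range (lin_ext f)" by (auto simp flip: lin_ext_scale)
qed

text \<open>The subalgebra generated by the \<open>X\<^sub>i(\<alpha>)\<close> is the linear span of their monomials.\<close>

lemma H_sub_eq: "H_sub S = range (lin_ext (gen_monom S))"
proof
  let ?R = "range (lin_ext (gen_monom S))"
  have R: "x \<in> ?R" if "x = lin_ext (gen_monom S) c" for x c
    using that by blast
  have "1 \<in> ?R" by (rule R[of _ "Poly_Mapping.single {#} 1"]) (simp del: single_one)
  moreover have "x * y \<in> ?R" if xy: "x \<in> ?R" "y \<in> ?R" for x y
  proof -
    obtain c d where "x = lin_ext (gen_monom S) c" "y = lin_ext (gen_monom S) d" using xy by blast
    then show ?thesis by (intro R[of _ "c * d"]) (simp add: lin_ext_mult)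
  qed
  ultimately have "subalgebra ?R"
    unfolding subalgebra_def using subspace_range_lin_ext by blast
  moreover have "gen S i \<alpha> \<in> ?R" for i \<alpha>
    by (rule R[of _ "Poly_Mapping.single {#(i, \<alpha>)#} 1"]) (simp add: gen_monom_def)
  ultimately show "H_sub S \<subseteq> ?R"
    unfolding H_sub_def by (intro hull_minimal) auto
next
  have mon: "gen_monom S m \<in> H_sub S" for m
  proof (induction m)
    case empty
    show ?case using subalgebra_H_sub[of S] by (simp add: subalgebra_def)
  next
    case (add d m)
    obtain i \<alpha> where "d = (i, \<alpha>)" by (cases d)
    with add show ?case
      using subalgebra_H_sub[of S] gen_in_H_sub[of S i \<alpha>] by (simp add: subalgebra_def)
  qed
  have sub: "pm.subspace (H_sub S)" using subalgebra_H_sub[of S] by (simp add: subalgebra_def)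
  have "lin_ext (gen_monom S) c \<in> H_sub S" for c
    unfolding lin_ext_def by (intro pm.subspace_sum pm.subspace_scale sub mon)
  then show "range (lin_ext (gen_monom S)) \<subseteq> H_sub S" by blast
qed

lemma gen_monom_in_H_sub: "gen_monom S m \<in> H_sub S"
proof -
  have "gen_monom S m = lin_ext (gen_monom S) (Poly_Mapping.single m 1)" by simp
  then show ?thesis unfolding H_sub_eq by blast
qed

text \<open>The forests of isolated vertices.\<close>

definition leafy :: "'d forest \<Rightarrow> bool" where
  "leafy F \<longleftrightarrow> set_mset F \<subseteq> range leaf"

text \<open>The projection onto the span of these forests along the span of the other ones; it is an algebra
  morphism.\<close>

definition leaf_part :: "('d forest \<Rightarrow>\<^sub>0 'k::field) \<Rightarrow> ('d forest \<Rightarrow>\<^sub>0 'k)" where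
  "leaf_part = lin_ext (\<lambda>F. if leafy F then Poly_Mapping.single F 1 else 0)"

lemma coef_leaf_part: "coef (leaf_part x) F = (if leafy F then coef x F else 0)"
  unfolding leaf_part_def
  by (induction x rule: pm_induct) (auto simp: lin_ext_add lookup_add lookup_single when_def)

lemma leaf_part_mult: "leaf_part (x * y) = leaf_part x * leaf_part y"
  unfolding leaf_part_def by (rule lin_ext_mult) (auto simp: leafy_def mult_single)

lemma leafy_leaves [simp]: "leafy (image_mset leaf m)"
  by (auto simp: leafy_def)

lemma image_mset_leaf_inject [simp]: "image_mset leaf m = image_mset leaf m' \<longleftrightarrow> m = m'"
  by (rule inj_eq[OF multiset.inj_map]) (simp add: inj_def)

lemma leaf_part_gen:
  fixes I :: "'m::finite \<Rightarrow> 'n::finite mdeg \<Rightarrow> 'm set"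
  shows "leaf_part (X I i \<alpha> :: _ \<Rightarrow>\<^sub>0 'k::field) = Poly_Mapping.single {#leaf (i, \<alpha>)#} 1"
proof (rule poly_mapping_eqI)
  fix F
  show "coef (leaf_part (X I i \<alpha> :: _ \<Rightarrow>\<^sub>0 'k)) F = coef (Poly_Mapping.single {#leaf (i, \<alpha>)#} 1) F"
  proof (cases "\<exists>j \<beta>. F = {#leaf (j, \<beta>)#}")
    case True
    then show ?thesis
      by (auto simp: coef_leaf_part coef_gen_leaf leafy_def lookup_single when_def split: if_splits)
  next
    case False
    have "coef (X I i \<alpha>) F = (0::'k)" if "leafy F"
    proof -
      have "F \<noteq> {#Node d G#}" for d G
        using that False by (cases d) (auto simp: leafy_def leaf_def)
      then show ?thesis by (simp add: coef_gen solution_not_tree)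
    qed
    with False show ?thesis by (auto simp: coef_leaf_part lookup_single when_def)
  qed
qed

text \<open>The generators are algebraically independent, and coordinates along the monomials in the
  generators are read off on the forests of isolated vertices.\<close>

lemma coef_gen_monom:
  fixes I :: "'m::finite \<Rightarrow> 'n::finite mdeg \<Rightarrow> 'm set"
  shows "coef (gen_monom (linear_sdse I) m) (image_mset leaf m') = (if m = m' then 1 else (0::'k::field))"
proof -
  have "leaf_part (gen_monom (linear_sdse I) m :: _ \<Rightarrow>\<^sub>0 'k) = Poly_Mapping.single (image_mset leaf m) 1"
  proof (induction m)
    case empty
    show ?case by (rule poly_mapping_eqI) (auto simp: coef_leaf_part coef_one lookup_single when_def leafy_def)
  next
    case (add d m)
    obtain i \<alpha> where "d = (i, \<alpha>)" by (cases d)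
    with add show ?case by (simp add: leaf_part_mult leaf_part_gen mult_single)
  qed
  then have "coef (leaf_part (gen_monom (linear_sdse I) m :: _ \<Rightarrow>\<^sub>0 'k)) (image_mset leaf m')
      = (if m = m' then 1 else 0)"
    by (simp add: lookup_single when_def)
  then show ?thesis by (simp add: coef_leaf_part)
qed

lemma coef_lin_ext_gen_monom:
  fixes I :: "'m::finite \<Rightarrow> 'n::finite mdeg \<Rightarrow> 'm set"
  shows "coef (lin_ext (gen_monom (linear_sdse I)) c) (image_mset leaf m) = (coef c m :: 'k::field)"
  by (induction c rule: pm_induct) (auto simp: lin_ext_add lookup_add coef_gen_monom lookup_single when_def)

lemma monom_coeff_eq:
  fixes I :: "'m::finite \<Rightarrow> 'n::finite mdeg \<Rightarrow> 'm set"
  assumes "x \<in> H_sub (linear_sdse I :: ('m, 'n, 'k::field) sdse)"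
  shows "monom_coeff (linear_sdse I) x m = coef x (image_mset leaf m)"
proof -
  obtain c where c: "x = lin_ext (gen_monom (linear_sdse I)) c"
    using assms unfolding H_sub_eq by blast
  have "(THE c. lin_ext (gen_monom (linear_sdse I)) c = x) = c"
  proof (rule the_equality)
    fix d assume "lin_ext (gen_monom (linear_sdse I)) d = x"
    then have "coef d m = coef c m" for m
      using c coef_lin_ext_gen_monom[of I d m] coef_lin_ext_gen_monom[of I c m] by simp
    then show "d = c" by (intro poly_mapping_eqI)
  qed (simp add: c)
  then show ?thesis by (simp add: monom_coeff_def c coef_lin_ext_gen_monom)
qed

lemma tensor_coeff_eq:
  fixes I :: "'m::finite \<Rightarrow> 'n::finite mdeg \<Rightarrow> 'm set"
  assumes "z \<in> range (lin_ext (\<lambda>(u, v). tensor (gen_monom (linear_sdse I) u) (gen_monom (linear_sdse I) v)))"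
  shows "tensor_coeff (linear_sdse I :: ('m, 'n, 'k::field) sdse) z m m' = coef z (image_mset leaf m, image_mset leaf m')"
proof -
  let ?t = "\<lambda>(u, v). tensor (gen_monom (linear_sdse I) u) (gen_monom (linear_sdse I :: ('m, 'n, 'k::field) sdse) v)"
  have coef: "coef (lin_ext ?t c) (image_mset leaf m, image_mset leaf m') = coef c (m, m')" for c m m'
    by (induction c rule: pm_induct)
      (auto simp: lin_ext_add lookup_add lookup_tensor coef_gen_monom lookup_single when_def split: if_splits)
  obtain c where c: "z = lin_ext ?t c"
    using assms by blast
  have "(THE c. lin_ext ?t c = z) = c"
  proof (rule the_equality)
    fix d assume "lin_ext ?t d = z"
    then have "coef d (m, m') = coef c (m, m')" for m m'
      using c coef[of d m m'] coef[of c m m'] by simp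
    then show "d = c" by (intro poly_mapping_eqI) auto
  qed (simp add: c)
  then show ?thesis by (simp add: tensor_coeff_def c coef)
qed

section \<open>A compatible system is Hopf\<close>

text \<open>The total degree of a monomial in the generators.\<close>

definition monom_size :: "('m \<times> 'n::finite mdeg) multiset \<Rightarrow> nat" where
  "monom_size m = (\<Sum>(i, \<alpha>)\<in>#m. msize \<alpha>)"

text \<open>The span of the tensors of two monomials whose left factor has total degree less than \<open>n\<close>.\<close>

definition lower_tensors ::
  "('m, 'n, 'k::field) sdse \<Rightarrow> nat
     \<Rightarrow> (('m \<times> 'n::finite mdeg) forest \<times> ('m \<times> 'n mdeg) forest \<Rightarrow>\<^sub>0 'k) set" where
  "lower_tensors S n =
     pm.span {tensor (gen_monom S u) (gen_monom S v) |u v. monom_size u < n}"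

lemma tensor_in_lower: "monom_size u < n \<Longrightarrow> tensor (gen_monom S u) (gen_monom S v) \<in> lower_tensors S n"
  unfolding lower_tensors_def by (rule pm.span_base) blast

lemma lower_tensors_mono: "a \<le> b \<Longrightarrow> lower_tensors S a \<subseteq> lower_tensors S b"
  unfolding lower_tensors_def by (rule pm.span_mono) auto

lemma lower_tensors_mult:
  assumes "x \<in> lower_tensors S a" "y \<in> lower_tensors S (Suc b)"
  shows "x * y \<in> lower_tensors S (a + b)"
  using assms(1) unfolding lower_tensors_def[of S a]
proof (induction rule: pm.span_induct)
  case base
  show ?case
    by (auto simp: pm.subspace_def distrib_right pm_scale_mult_left lower_tensors_def
        intro: pm.span_zero pm.span_add pm.span_scale)
next
  case (step x)
  then obtain u v where x: "x = tensor (gen_monom S u) (gen_monom S v)" "monom_size u < a" by blast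
  show ?case
    using assms(2) unfolding lower_tensors_def[of S "Suc b"]
  proof (induction rule: pm.span_induct)
    case base
    show ?case
      by (auto simp: pm.subspace_def distrib_left pm_scale_mult_right lower_tensors_def
          intro: pm.span_zero pm.span_add pm.span_scale)
  next
    case (step y)
    then obtain u' v' where y: "y = tensor (gen_monom S u') (gen_monom S v')" "monom_size u' < Suc b" by blast
    have "tensor (gen_monom S (u + u')) (gen_monom S (v + v')) \<in> lower_tensors S (a + b)"
      using x y by (intro tensor_in_lower) (simp add: monom_size_def)
    then show ?case by (simp add: x y tensor_mult)
  qed
qed

text \<open>Both the stability under the coproduct and, by induction, the one under the antipode follow from
  this triangular shape.\<close>

lemma coproduct_gen_monom:
  fixes I :: "'m::finite \<Rightarrow> 'n::finite mdeg \<Rightarrow> 'm set"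
  defines "S \<equiv> linear_sdse I :: ('m, 'n, 'k::field) sdse"
  assumes I: "compatible I"
  shows "coproduct (gen_monom S m) - tensor (gen_monom S m) 1 \<in> lower_tensors S (monom_size m)"
proof (induction m)
  case empty
  show ?case by (simp add: coproduct_1 tensor_1_1 lower_tensors_def pm.span_zero)
next
  case (add d m)
  obtain i \<alpha> where d: "d = (i, \<alpha>)" by (cases d)
  have base: "tensor 1 (gen S i \<alpha>) \<in> lower_tensors S (msize \<alpha>)"
    using tensor_in_lower[of "{#}" "msize \<alpha>" S "{#(i, \<alpha>)#}"] msize_pos[of \<alpha>]
    by (simp add: monom_size_def)
  have "tensor (gen S k \<gamma>) (gen S i \<beta>) \<in> lower_tensors S (msize \<alpha>)" if "\<beta> + \<gamma> = \<alpha>" for k \<beta> \<gamma>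
    using tensor_in_lower[of "{#(k, \<gamma>)#}" "msize \<alpha>" S "{#(i, \<beta>)#}"] msize_pos[of \<beta>] that
    by (auto simp: monom_size_def)
  then have z: "coproduct (gen S i \<alpha>) - tensor (gen S i \<alpha>) 1 \<in> lower_tensors S (msize \<alpha>)" (is "?z \<in> _")
    using base unfolding S_def coproduct_gen[OF I]
    by (auto simp: lower_tensors_def decomp_iff intro!: pm.span_add pm.span_sum)
  have w: "coproduct (gen_monom S m) - tensor (gen_monom S m) 1 \<in> lower_tensors S (monom_size m)" (is "?w \<in> _")
    by (rule add)
  have "tensor (gen S i \<alpha>) 1 \<in> lower_tensors S (Suc (msize \<alpha>))"
    using tensor_in_lower[of "{#(i, \<alpha>)#}" "Suc (msize \<alpha>)" S "{#}"] by (simp add: monom_size_def)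
  then have "?w * tensor (gen S i \<alpha>) 1 \<in> lower_tensors S (monom_size m + msize \<alpha>)"
    by (rule lower_tensors_mult[OF w])
  moreover have "?z * tensor (gen_monom S m) 1 \<in> lower_tensors S (msize \<alpha> + monom_size m)"
    using tensor_in_lower[of m "Suc (monom_size m)" S "{#}"] by (intro lower_tensors_mult[OF z]) simp
  moreover have "?z * ?w \<in> lower_tensors S (msize \<alpha> + monom_size m)"
    using w lower_tensors_mono[of "monom_size m" "Suc (monom_size m)" S] by (intro lower_tensors_mult[OF z]) auto
  ultimately have "?w * tensor (gen S i \<alpha>) 1 + ?z * tensor (gen_monom S m) 1 + ?z * ?w
      \<in> lower_tensors S (msize \<alpha> + monom_size m)"
    by (simp add: lower_tensors_def pm.span_add add.commute)
  also have "?w * tensor (gen S i \<alpha>) 1 + ?z * tensor (gen_monom S m) 1 + ?z * ?w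
     = coproduct (gen S i \<alpha> * gen_monom S m) - tensor (gen S i \<alpha>) 1 * tensor (gen_monom S m) 1"
    by (simp add: coproduct_mult algebra_simps)
  finally show ?case by (simp add: d monom_size_def tensor_mult)
qed

text \<open>The linear map in the definition of the convolution \<open>s * id\<close>, on a pure tensor.\<close>

lemma lin_ext_conv_tensor:
  fixes s :: "('d forest \<Rightarrow>\<^sub>0 'k::field) \<Rightarrow> ('d forest \<Rightarrow>\<^sub>0 'k)"
  assumes "Vector_Spaces.linear pm_scale pm_scale s"
  shows "lin_ext (\<lambda>(F, G). s (Poly_Mapping.single F 1) * Poly_Mapping.single G 1) (tensor p q)
    = s p * q"
proof -
  interpret s: Vector_Spaces.linear pm_scale pm_scale s by fact
  let ?f = "\<lambda>(F, G). s (Poly_Mapping.single F 1) * Poly_Mapping.single G (1::'k)"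
  have single: "pm_scale c (Poly_Mapping.single F 1) = Poly_Mapping.single F (c::'k)" for c and F :: "'d forest"
    by (rule poly_mapping_eqI) (auto simp: lookup_single when_def)
  have "lin_ext ?f (tensor (Poly_Mapping.single F c) q) = s (Poly_Mapping.single F c) * q" for F c
  proof (induction q rule: pm_induct)
    case (add G e q)
    have "lin_ext ?f (tensor (pm_scale c (Poly_Mapping.single F 1)) (pm_scale e (Poly_Mapping.single G 1)))
        = s (pm_scale c (Poly_Mapping.single F 1)) * pm_scale e (Poly_Mapping.single G 1)"
      by (simp add: tensor_scale_left tensor_scale_right tensor_single lin_ext_scale s.scale
          pm_scale_mult_left pm_scale_mult_right mult.commute)
    then have "lin_ext ?f (tensor (Poly_Mapping.single F c) (Poly_Mapping.single G e))
        = s (Poly_Mapping.single F c) * Poly_Mapping.single G e"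
      unfolding single .
    with add show ?case by (simp add: tensor_add_right lin_ext_add distrib_left)
  qed simp
  then show ?thesis
    by (induction p rule: pm_induct) (simp_all add: s.zero s.add tensor_add_left lin_ext_add distrib_right)
qed

lemma compatible_imp_hopf:
  fixes I :: "'m::finite \<Rightarrow> 'n::finite mdeg \<Rightarrow> 'm set"
  assumes I: "compatible I"
  shows "hopf_sdse (linear_sdse I :: ('m, 'n, 'k::field) sdse)"
proof -
  define S where "S = (linear_sdse I :: ('m, 'n, 'k) sdse)"
  let ?A = "H_sub S"
  have sub: "pm.subspace ?A" and one: "1 \<in> ?A" and mult: "\<And>x y. x \<in> ?A \<Longrightarrow> y \<in> ?A \<Longrightarrow> x * y \<in> ?A"
    using subalgebra_H_sub[of S] by (auto simp: subalgebra_def)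
  note cop = coproduct_gen_monom[OF I, where 'k = 'k, folded S_def]
  have "coproduct x \<in> tensor_sub ?A ?A" if "x \<in> ?A" for x
  proof -
    have "coproduct (gen_monom S m) \<in> tensor_sub ?A ?A" for m
    proof -
      have "lower_tensors S (monom_size m) \<subseteq> tensor_sub ?A ?A"
        unfolding lower_tensors_def tensor_sub_def using gen_monom_in_H_sub by (intro pm.span_mono) blast
      moreover have "tensor (gen_monom S m) 1 \<in> tensor_sub ?A ?A"
        unfolding tensor_sub_def using gen_monom_in_H_sub one by (intro pm.span_base) blast
      ultimately have "coproduct (gen_monom S m) - tensor (gen_monom S m) 1 + tensor (gen_monom S m) 1
          \<in> tensor_sub ?A ?A"
        using cop[of m] unfolding tensor_sub_def by (intro pm.span_add) auto
      then show ?thesis by simp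
    qed
    then have "coproduct (lin_ext (gen_monom S) c) \<in> tensor_sub ?A ?A" for c
      by (induction c rule: pm_induct)
        (auto simp: lin_ext_add coproduct_add coproduct_scale tensor_sub_def
          intro: pm.span_zero pm.span_add pm.span_scale)
    with that show ?thesis unfolding H_sub_eq by blast
  qed
  moreover have "s x \<in> ?A" if s: "is_antipode s" and x: "x \<in> ?A" for s x
  proof -
    have lin: "Vector_Spaces.linear pm_scale pm_scale s" using s by (simp add: is_antipode_def)
    interpret s: Vector_Spaces.linear pm_scale pm_scale s by fact
    let ?f = "\<lambda>(F, G). s (Poly_Mapping.single F 1) * Poly_Mapping.single G (1::'k)"
    \<comment> \<open>The identity \<open>s * id = counit\<close> at \<open>m\<close> expresses \<open>s m\<close> by the values of \<open>s\<close> at monomials of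
      smaller degree.\<close>
    have "s (gen_monom S m) \<in> ?A" for m
    proof (induction "monom_size m" arbitrary: m rule: less_induct)
      case less
      let ?z = "coproduct (gen_monom S m) - tensor (gen_monom S m) 1"
      have "lin_ext ?f z \<in> ?A" if "z \<in> lower_tensors S (monom_size m)" for z
        using that unfolding lower_tensors_def
      proof (induction rule: pm.span_induct)
        case base
        show ?case
          using sub by (auto simp: pm.subspace_def lin_ext_add lin_ext_scale)
      next
        case (step z)
        then show ?case
          using less by (auto simp: lin_ext_conv_tensor[OF lin] intro!: mult gen_monom_in_H_sub)
      qed
      then have "lin_ext ?f ?z \<in> ?A" using cop by blast
      moreover have "conv s id (gen_monom S m) \<in> ?A"
        using s one sub by (simp add: is_antipode_def pm.subspace_scale)
      moreover have "conv s id (gen_monom S m) = lin_ext ?f (tensor (gen_monom S m) 1 + ?z)"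
        by (simp add: conv_def)
      then have "s (gen_monom S m) = conv s id (gen_monom S m) - lin_ext ?f ?z"
        unfolding lin_ext_add lin_ext_conv_tensor[OF lin] by simp
      ultimately show ?case using sub by (simp add: pm.subspace_diff)
    qed
    then have "s (lin_ext (gen_monom S) c) \<in> ?A" for c
      using sub by (induction c rule: pm_induct)
        (auto simp: lin_ext_add s.zero s.add s.scale pm.subspace_def)
    with x show ?thesis unfolding H_sub_eq by blast
  qed
  ultimately show ?thesis
    using subalgebra_H_sub unfolding hopf_sdse_def hopf_subalgebra_def S_def by blast
qed


section \<open>Compatible systems and Hopf graphs\<close>

text \<open>The sets are recovered by evaluating the system at one-vertex trees, for the family of series that are
  constantly \<open>1\<close> at the index \<open>l\<close> and \<open>0\<close> at the other indices.\<close>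

lemma linear_sdse_inject:
  fixes I J :: "'m::finite \<Rightarrow> 'n::finite mdeg \<Rightarrow> 'm set"
  assumes "linear_sdse I = (linear_sdse J :: ('m, 'n, 'k::field) sdse)"
  shows "I = J"
proof -
  have "l \<in> I i \<alpha> \<longleftrightarrow> l \<in> J i \<alpha>" for i \<alpha> l
  proof -
    let ?Y = "\<lambda>j F. if j = l then 1 else (0::'k)"
    have "linear_sdse I ?Y i {#Node (i, \<alpha>) {#}#} = linear_sdse J ?Y i {#Node (i, \<alpha>) {#}#}"
      by (simp only: assms)
    then show ?thesis by (simp add: linear_sdse_tree split: if_splits)
  qed
  then show ?thesis by (intro ext) blast
qed

lemma hopf_graph_imp_compatible:
  assumes "hopf_graph G"
  shows "compatible (\<lambda>i \<alpha>. {j. reach G i (mvec \<alpha>) j})"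
  using assms unfolding hopf_graph_def compatible_def by blast

text \<open>The degree of a single edge of colour \<open>p\<close>.\<close>

definition unit_deg :: "'n \<Rightarrow> 'n::finite mdeg" where
  "unit_deg p = Abs_mdeg (axis p 1)"

lemma mvec_unit_deg: "mvec (unit_deg p) = axis p 1"
  unfolding unit_deg_def by (rule Abs_mdeg_inverse) (auto simp: vec_eq_iff axis_def)

text \<open>The graph of a system: its edges are read off in the degrees of single edges.\<close>

definition unit_graph :: "('m \<Rightarrow> 'n::finite mdeg \<Rightarrow> 'm set) \<Rightarrow> ('m, 'n) cgraph" where
  "unit_graph I = {(i, p, j). j \<in> I i (unit_deg p)}"

lemma reach_refl: "reach G i 0 i"
  unfolding reach_def by (rule exI[of _ "[]"]) simp

lemma reach_step:
  assumes "(i, p, k) \<in> G" "reach G k v j"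
  shows "reach G i (axis p 1 + v) j"
proof -
  obtain es where "walk G k es j" "\<forall>p. count_list (map (\<lambda>(u, c, v). c) es) p = v $ p"
    using assms(2) by (auto simp: reach_def)
  with assms(1) show ?thesis
    unfolding reach_def by (intro exI[of _ "(i, p, k) # es"]) (auto simp: axis_def)
qed

lemma reach_induct [consumes 1, case_names refl step]:
  assumes "reach G i v j"
    and refl: "\<And>j. P j 0 j"
    and step: "\<And>i p k v j. (i, p, k) \<in> G \<Longrightarrow> P k v j \<Longrightarrow> P i (axis p 1 + v) j"
  shows "P i v j"
proof -
  have "P i (\<chi> p. count_list (map (\<lambda>(u, c, v). c) es) p) j" if "walk G i es j" for es
    using that
  proof (induction es arbitrary: i)
    case Nil
    then show ?case using refl[of j] by (simp add: zero_vec_def)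
  next
    case (Cons e es)
    obtain u p v where e: "e = (u, p, v)" by (cases e)
    have "P i (axis p 1 + (\<chi> p. count_list (map (\<lambda>(u, c, v). c) es) p)) j"
      using Cons by (intro step[of i p v]) (auto simp: e)
    also have "axis p 1 + (\<chi> p. count_list (map (\<lambda>(u, c, v). c) es) p)
        = (\<chi> q. count_list (map (\<lambda>(u, c, v). c) (e # es)) q)"
      by (auto simp: vec_eq_iff axis_def e)
    finally show ?case .
  qed
  moreover obtain es where es: "walk G i es j" "\<forall>p. count_list (map (\<lambda>(u, c, v). c) es) p = v $ p"
    using assms(1) by (auto simp: reach_def)
  moreover have "(\<chi> p. count_list (map (\<lambda>(u, c, v). c) es) p) = v"
    using es(2) by (simp add: vec_eq_iff)
  ultimately show ?thesis by fastforce
qed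

text \<open>Nonemptiness provides the intermediate vertices of a path that realises a given degree.\<close>

lemma reach_unit_graph:
  fixes I :: "'m \<Rightarrow> 'n::finite mdeg \<Rightarrow> 'm set"
  assumes I: "compatible I" and nonempty: "\<And>i \<alpha>. I i \<alpha> \<noteq> {}"
  shows "reach (unit_graph I) i (mvec \<alpha>) j \<longleftrightarrow> j \<in> I i \<alpha>"
proof
  have "if v = 0 then i = j else j \<in> I i (Abs_mdeg v)" if "reach (unit_graph I) i v j" for v
    using that
  proof (induction rule: reach_induct)
    case (step i p k v j)
    then have k: "k \<in> I i (unit_deg p)" by (simp add: unit_graph_def)
    show ?case
    proof (cases "v = 0")
      case True
      with step k show ?thesis by (simp add: unit_deg_def)
    next
      case False
      then have v: "mvec (Abs_mdeg v) = v" by (simp add: Abs_mdeg_inverse)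
      then have "Abs_mdeg (axis p 1 + v) = unit_deg p + Abs_mdeg v"
        by (simp add: plus_mdeg_def mvec_unit_deg)
      moreover have "j \<in> I i (unit_deg p + Abs_mdeg v)"
        using I k step False unfolding compatible_def by auto
      moreover have "axis p 1 + v \<noteq> 0"
        using mdeg_add_nonzero[of "mvec (unit_deg p)" v] by (simp add: mvec_unit_deg)
      ultimately show ?thesis by simp
    qed
  qed simp
  from this[of "mvec \<alpha>"] show "j \<in> I i \<alpha>" if "reach (unit_graph I) i (mvec \<alpha>) j"
    using that by (simp add: mvec_inverse)
next
  show "reach (unit_graph I) i (mvec \<alpha>) j" if "j \<in> I i \<alpha>"
    using that
  proof (induction "msize \<alpha>" arbitrary: i \<alpha> rule: less_induct)
    case less
    obtain p where p: "mvec \<alpha> $ p \<noteq> 0"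
      using mvec_neq_0(1)[of \<alpha>] unfolding vec_eq_iff by auto
    define v where "v = mvec \<alpha> - axis p 1"
    have v: "mvec \<alpha> = axis p 1 + v"
      using p by (auto simp: v_def vec_eq_iff axis_def)
    show ?case
    proof (cases "v = 0")
      case True
      then have "\<alpha> = unit_deg p" using v by (simp add: mvec_inject[symmetric] mvec_unit_deg)
      with less.prems have "(i, p, j) \<in> unit_graph I" by (simp add: unit_graph_def)
      from reach_step[OF this reach_refl] show ?thesis by (simp add: v True)
    next
      case False
      define \<gamma> where "\<gamma> = Abs_mdeg v"
      have \<gamma>: "mvec \<gamma> = v" using False by (simp add: \<gamma>_def Abs_mdeg_inverse)
      have \<alpha>: "\<alpha> = unit_deg p + \<gamma>"
        by (simp add: mvec_inject[symmetric] mvec_add mvec_unit_deg \<gamma> v)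
      obtain k where k: "k \<in> I i (unit_deg p)" using nonempty[of i "unit_deg p"] by blast
      then have "j \<in> I k \<gamma>" using I less.prems unfolding compatible_def \<alpha> by blast
      then have "reach (unit_graph I) k (mvec \<gamma>) j"
        using msize_pos[of "unit_deg p"] by (intro less) (simp_all add: \<alpha>)
      then show ?thesis
        unfolding v using k by (intro reach_step[of _ _ k]) (auto simp: unit_graph_def \<gamma>)
    qed
  qed
qed

section \<open>The dual pre-Lie algebra\<close>

lemma dual_gen_eq:
  fixes I :: "'m::finite \<Rightarrow> 'n::finite mdeg \<Rightarrow> 'm set"
  defines "S \<equiv> linear_sdse I :: ('m, 'n, 'k::field) sdse"
  shows "dual_gen S i \<alpha> x = (if x \<in> H_sub S then coef x {#leaf (i, \<alpha>)#} else 0)"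
  by (simp add: dual_gen_def S_def monom_coeff_eq)

lemma dual_gen_gen:
  fixes I :: "'m::finite \<Rightarrow> 'n::finite mdeg \<Rightarrow> 'm set"
  defines "S \<equiv> linear_sdse I :: ('m, 'n, 'k::field) sdse"
  shows "dual_gen S i \<alpha> (gen S j \<beta>) = (if (i, \<alpha>) = (j, \<beta>) then 1 else 0)"
  using gen_in_H_sub[of "linear_sdse I :: ('m, 'n, 'k) sdse"]
  by (auto simp: S_def dual_gen_eq coef_gen_leaf)

lemma dual_gen_in_dual_prelie:
  fixes I :: "'m::finite \<Rightarrow> 'n::finite mdeg \<Rightarrow> 'm set"
  defines "S \<equiv> linear_sdse I :: ('m, 'n, 'k::field) sdse"
  shows "dual_gen S i \<alpha> \<in> dual_prelie S"
proof -
  have sub: "subalgebra (H_sub S)" by (rule subalgebra_H_sub)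
  have "\<exists>A. finite A \<and> (\<forall>\<delta>. \<delta> \<notin> A \<longrightarrow>
      (\<forall>x\<in>H_sub S. (\<forall>F\<in>Poly_Mapping.keys x. forest_deg F = \<delta>) \<longrightarrow> dual_gen S i \<alpha> x = 0))"
  proof (intro exI[of _ "{mvec \<alpha>}"] conjI allI impI ballI)
    fix \<delta> :: "nat ^ 'n" and x :: "('m \<times> 'n mdeg) forest \<Rightarrow>\<^sub>0 'k"
    assume "\<delta> \<notin> {mvec \<alpha>}" "\<forall>F\<in>Poly_Mapping.keys x. forest_deg F = \<delta>"
    then have "{#leaf (i, \<alpha>)#} \<notin> Poly_Mapping.keys x" by (metis forest_deg_leaf singletonI)
    then show "dual_gen S i \<alpha> x = 0"
      by (simp add: S_def dual_gen_eq in_keys_iff)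
  qed simp
  with sub show ?thesis
    by (auto simp: dual_prelie_def graded_dual_def S_def dual_gen_eq lookup_add subalgebra_def
        pm.subspace_def lookup_mult_tree counit_def)
qed

text \<open>A primitive functional lives in finitely many degrees.\<close>

lemma dual_prelie_bounded:
  assumes "\<phi> \<in> dual_prelie S"
  obtains A where "finite A"
    "\<And>\<delta> x. \<delta> \<notin> A \<Longrightarrow> x \<in> H_sub S \<Longrightarrow> (\<forall>F\<in>Poly_Mapping.keys x. forest_deg F = \<delta>) \<Longrightarrow> \<phi> x = 0"
proof -
  have "\<exists>A. finite A \<and> (\<forall>\<delta>. \<delta> \<notin> A \<longrightarrow>
      (\<forall>x\<in>H_sub S. (\<forall>F\<in>Poly_Mapping.keys x. forest_deg F = \<delta>) \<longrightarrow> \<phi> x = 0))"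
    using assms by (simp add: dual_prelie_def graded_dual_def)
  then show ?thesis using that by blast
qed

lemma subspace_dual_prelie: "fn.subspace (dual_prelie S)"
proof -
  have sub: "subalgebra (H_sub S)" by (rule subalgebra_H_sub)
  have zero: "0 \<in> dual_prelie S"
    by (auto simp: dual_prelie_def graded_dual_def)
  have add: "\<phi> + \<psi> \<in> dual_prelie S" if "\<phi> \<in> dual_prelie S" "\<psi> \<in> dual_prelie S" for \<phi> \<psi>
  proof -
    obtain A B where AB: "finite A" "finite B"
      "\<And>\<delta> x. \<delta> \<notin> A \<Longrightarrow> x \<in> H_sub S \<Longrightarrow> (\<forall>F\<in>Poly_Mapping.keys x. forest_deg F = \<delta>) \<Longrightarrow> \<phi> x = 0"
      "\<And>\<delta> x. \<delta> \<notin> B \<Longrightarrow> x \<in> H_sub S \<Longrightarrow> (\<forall>F\<in>Poly_Mapping.keys x. forest_deg F = \<delta>) \<Longrightarrow> \<psi> x = 0"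
      using dual_prelie_bounded[OF \<open>\<phi> \<in> dual_prelie S\<close>] dual_prelie_bounded[OF \<open>\<psi> \<in> dual_prelie S\<close>] by metis
    have "\<exists>A. finite A \<and> (\<forall>\<delta>. \<delta> \<notin> A \<longrightarrow>
      (\<forall>x\<in>H_sub S. (\<forall>F\<in>Poly_Mapping.keys x. forest_deg F = \<delta>) \<longrightarrow> (\<phi> + \<psi>) x = 0))"
      using AB by (intro exI[of _ "A \<union> B"]) auto
    with that show ?thesis
      by (auto simp: dual_prelie_def graded_dual_def algebra_simps)
  qed
  have scale: "fun_scale c \<phi> \<in> dual_prelie S" if "\<phi> \<in> dual_prelie S" for c \<phi>
  proof -
    obtain A where A: "finite A"
      "\<And>\<delta> x. \<delta> \<notin> A \<Longrightarrow> x \<in> H_sub S \<Longrightarrow> (\<forall>F\<in>Poly_Mapping.keys x. forest_deg F = \<delta>) \<Longrightarrow> \<phi> x = 0"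
      using dual_prelie_bounded[OF \<open>\<phi> \<in> dual_prelie S\<close>] by metis
    have "\<exists>A. finite A \<and> (\<forall>\<delta>. \<delta> \<notin> A \<longrightarrow>
      (\<forall>x\<in>H_sub S. (\<forall>F\<in>Poly_Mapping.keys x. forest_deg F = \<delta>) \<longrightarrow> fun_scale c \<phi> x = 0))"
      using A by (intro exI[of _ A]) (auto simp: fun_scale_def)
    with that show ?thesis
      by (auto simp: dual_prelie_def graded_dual_def fun_scale_def algebra_simps)
  qed
  show ?thesis
    unfolding fn.subspace_def using zero add scale by blast
qed

text \<open>As the counit vanishes on the generators, a primitive functional vanishes on all monomials but the
  generators.\<close>

lemma dual_prelie_eqI:
  fixes I :: "'m::finite \<Rightarrow> 'n::finite mdeg \<Rightarrow> 'm set"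
  defines "S \<equiv> linear_sdse I :: ('m, 'n, 'k::field) sdse"
  assumes \<phi>: "\<phi> \<in> dual_prelie S" and \<psi>: "\<psi> \<in> dual_prelie S"
    and eq: "\<And>i \<alpha>. \<phi> (gen S i \<alpha>) = \<psi> (gen S i \<alpha>)"
  shows "\<phi> = \<psi>"
proof -
  have sub: "pm.subspace (H_sub S)" and one: "1 \<in> H_sub S"
    using subalgebra_H_sub[of S] by (auto simp: subalgebra_def)
  have plus: "\<theta> (x + y) = \<theta> x + \<theta> y" if "\<theta> \<in> dual_prelie S" "x \<in> H_sub S" "y \<in> H_sub S" for \<theta> x y
    using that by (simp add: dual_prelie_def graded_dual_def)
  have scale: "\<theta> (pm_scale c x) = c * \<theta> x" if "\<theta> \<in> dual_prelie S" "x \<in> H_sub S" for \<theta> c x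
    using that by (simp add: dual_prelie_def graded_dual_def)
  have mult: "\<theta> (x * y) = \<theta> x * counit y + counit x * \<theta> y"
    if "\<theta> \<in> dual_prelie S" "x \<in> H_sub S" "y \<in> H_sub S" for \<theta> x y
    using that by (simp add: dual_prelie_def)
  have one0: "\<theta> 1 = 0" if "\<theta> \<in> dual_prelie S" for \<theta>
  proof -
    have "counit (1 :: ('m \<times> 'n mdeg) forest \<Rightarrow>\<^sub>0 'k) = 1" by (simp add: counit_def coef_one)
    then have "\<theta> 1 = \<theta> 1 + \<theta> 1"
      using mult[OF that one one] by (simp only: mult_1_left mult_1_right)
    then show ?thesis by (simp only: add_cancel_right_right)
  qed
  have monom: "\<phi> (gen_monom S m) = \<psi> (gen_monom S m)" for m
  proof (induction m)
    case empty
    show ?case by (simp add: one0[OF \<phi>] one0[OF \<psi>])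
  next
    case (add d m)
    obtain i \<alpha> where "d = (i, \<alpha>)" by (cases d)
    with add show ?case
      using mult[OF \<phi> gen_in_H_sub gen_monom_in_H_sub] mult[OF \<psi> gen_in_H_sub gen_monom_in_H_sub]
      by (simp add: eq)
  qed
  have lin: "lin_ext (gen_monom S) c \<in> H_sub S" for c
    unfolding H_sub_eq by blast
  have zero: "\<theta> 0 = 0" if "\<theta> \<in> dual_prelie S" for \<theta>
    using scale[OF that one, of 0] by simp
  have "\<phi> (lin_ext (gen_monom S) c) = \<psi> (lin_ext (gen_monom S) c)" for c
  proof (induction c rule: pm_induct)
    case (add m a c)
    have step: "\<theta> (lin_ext (gen_monom S) (Poly_Mapping.single m a + c))
        = a * \<theta> (gen_monom S m) + \<theta> (lin_ext (gen_monom S) c)" if "\<theta> \<in> dual_prelie S" for \<theta>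
      using sub by (simp add: lin_ext_add plus[OF that] lin scale[OF that] gen_monom_in_H_sub pm.subspace_scale)
    show ?case unfolding step[OF \<phi>] step[OF \<psi>] by (simp add: add monom)
  qed (simp add: zero[OF \<phi>] zero[OF \<psi>])
  then have "\<phi> x = \<psi> x" if "x \<in> H_sub S" for x
    using that unfolding H_sub_eq by blast
  moreover have "\<phi> x = \<psi> x" if "x \<notin> H_sub S" for x
    using that \<phi> \<psi> by (simp add: dual_prelie_def graded_dual_def)
  ultimately show ?thesis by blast
qed

lemma finite_dual_prelie_support:
  fixes I :: "'m::finite \<Rightarrow> 'n::finite mdeg \<Rightarrow> 'm set"
  defines "S \<equiv> linear_sdse I :: ('m, 'n, 'k::field) sdse"
  assumes \<phi>: "\<phi> \<in> dual_prelie S"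
  shows "finite {(j, \<beta>). \<phi> (gen S j \<beta>) \<noteq> 0}"
proof -
  obtain A where A: "finite A"
    "\<And>\<delta> x. \<delta> \<notin> A \<Longrightarrow> x \<in> H_sub S \<Longrightarrow> (\<forall>F\<in>Poly_Mapping.keys x. forest_deg F = \<delta>) \<Longrightarrow> \<phi> x = 0"
    using dual_prelie_bounded[OF \<phi>] by metis
  have "\<phi> (gen S j \<beta>) = 0" if "mvec \<beta> \<notin> A" for j \<beta>
    using that gen_in_H_sub
    by (rule A(2)) (auto simp: S_def in_keys_iff coef_gen split: if_splits)
  then have "{(j, \<beta>). \<phi> (gen S j \<beta>) \<noteq> 0} \<subseteq> UNIV \<times> mvec -` A" by auto
  moreover have "finite (mvec -` A)"
    using A(1) by (rule finite_vimageI) (auto simp: inj_def mvec_inject)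
  ultimately show ?thesis using finite_subset[OF _ finite_cartesian_product[OF finite]] by blast
qed

lemma is_basis_dual_gen:
  fixes I :: "'m::finite \<Rightarrow> 'n::finite mdeg \<Rightarrow> 'm set"
  defines "S \<equiv> linear_sdse I :: ('m, 'n, 'k::field) sdse"
  shows "is_basis (\<lambda>(i, \<alpha>). dual_gen S i \<alpha>) (dual_prelie S)"
proof -
  let ?b = "\<lambda>(i, \<alpha>). dual_gen S i \<alpha>"
  let ?g = "\<lambda>(i, \<alpha>). gen S i \<alpha>"
  have b: "?b p (?g q) = (if p = q then 1 else 0)" for p q
    by (auto simp: S_def dual_gen_gen split: prod.splits)
  have inj: "inj ?b"
  proof (rule injI)
    fix p q assume "?b p = ?b q"
    then have "?b p (?g p) = ?b q (?g p)" by simp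
    then show "p = q" unfolding b by (simp split: if_splits)
  qed
  moreover have "fn.independent (range ?b)"
    unfolding fn.independent_explicit_module
  proof (intro allI impI)
    fix t u v
    assume t: "finite t" "t \<subseteq> range ?b" "(\<Sum>v\<in>t. fun_scale (u v) v) = 0" "v \<in> t"
    then obtain p where p: "v = ?b p" by blast
    have val: "w (?g p) = (if w = v then 1 else 0)" if "w \<in> t" for w
    proof -
      from that t obtain q where q: "w = ?b q" by blast
      have "w = v \<longleftrightarrow> q = p" unfolding p q using inj by (auto dest: injD)
      then show ?thesis unfolding q b by simp
    qed
    have "(\<Sum>w\<in>t. fun_scale (u w) w) (?g p) = (\<Sum>w\<in>t. if w = v then u v else 0)"
      unfolding sum_fun_apply
    proof (rule sum.cong[OF refl])
      fix w assume "w \<in> t"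
      from val[OF this] show "fun_scale (u w) w (?g p) = (if w = v then u v else 0)"
        by (simp add: fun_scale_def)
    qed
    with t show "u v = 0" by simp
  qed
  moreover have "fn.span (range ?b) = dual_prelie S"
  proof
    show "fn.span (range ?b) \<subseteq> dual_prelie S"
      using dual_gen_in_dual_prelie[of I] subspace_dual_prelie
      by (intro fn.span_minimal) (auto simp: S_def)
    show "dual_prelie S \<subseteq> fn.span (range ?b)"
    proof
      fix \<phi> assume \<phi>: "\<phi> \<in> dual_prelie S"
      let ?T = "{p. \<phi> (?g p) \<noteq> 0}"
      let ?\<psi> = "\<Sum>p\<in>?T. fun_scale (\<phi> (?g p)) (?b p)"
      have fin: "finite ?T"
        using finite_dual_prelie_support[of \<phi> I] \<phi> by (simp add: S_def case_prod_unfold)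
      have "\<phi> = ?\<psi>"
      proof (rule dual_prelie_eqI[where I = I and 'k = 'k, folded S_def])
        show "?\<psi> \<in> dual_prelie S"
          using dual_gen_in_dual_prelie[of I] subspace_dual_prelie
          by (intro fn.subspace_sum fn.subspace_scale) (auto simp: S_def)
        fix i \<alpha>
        have "?\<psi> (?g (i, \<alpha>)) = (\<Sum>p\<in>?T. if p = (i, \<alpha>) then \<phi> (?g (i, \<alpha>)) else 0)"
          unfolding sum_fun_apply fun_scale_def b by (intro sum.cong) auto
        also have "\<dots> = \<phi> (?g (i, \<alpha>))"
          using fin by simp
        finally show "\<phi> (gen S i \<alpha>) = ?\<psi> (gen S i \<alpha>)" by simp
      qed (rule \<phi>)
      also have "?\<psi> \<in> fn.span (range ?b)"
        by (intro fn.span_sum fn.span_scale fn.span_base) blast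
      finally show "\<phi> \<in> fn.span (range ?b)" .
    qed
  qed
  ultimately show ?thesis by (simp add: is_basis_def)
qed

lemma struct_const_eq:
  fixes I :: "'m::finite \<Rightarrow> 'n::finite mdeg \<Rightarrow> 'm set"
  defines "S \<equiv> linear_sdse I :: ('m, 'n, 'k::field) sdse"
  assumes I: "compatible I"
  shows "struct_const S j \<beta> i \<alpha> = (if j \<in> I i \<alpha> then 1 else 0)"
proof -
  let ?t = "\<lambda>(u, v). tensor (gen_monom S u) (gen_monom S v)"
  let ?z = "coproduct (gen S i (\<alpha> + \<beta>)) - tensor (gen S i (\<alpha> + \<beta>)) 1"
  have z: "?z = tensor 1 (gen S i (\<alpha> + \<beta>))
      + (\<Sum>(\<alpha>', \<beta>')\<in>decomp (\<alpha> + \<beta>). \<Sum>k\<in>I i \<alpha>'. tensor (gen S k \<beta>') (gen S i \<alpha>'))"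
    unfolding S_def coproduct_gen[OF I] by simp
  have R: "tensor (gen_monom S u) (gen_monom S v) \<in> range (lin_ext ?t)" for u v
    by (rule range_eqI[of _ _ "Poly_Mapping.single (u, v) 1"]) simp
  have "tensor 1 (gen S i (\<alpha> + \<beta>)) \<in> range (lin_ext ?t)"
    using R[of "{#}" "{#(i, \<alpha> + \<beta>)#}"] by simp
  moreover have "tensor (gen S k \<beta>') (gen S i \<alpha>') \<in> range (lin_ext ?t)" for k \<alpha>' \<beta>'
    using R[of "{#(k, \<beta>')#}" "{#(i, \<alpha>')#}"] by simp
  ultimately have "?z \<in> range (lin_ext ?t)"
    unfolding z case_prod_beta by (intro pm.subspace_add pm.subspace_sum subspace_range_lin_ext)
  then have "struct_const S j \<beta> i \<alpha> = coef ?z ({#leaf (j, \<beta>)#}, {#leaf (i, \<alpha>)#})"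
    unfolding struct_const_def S_def by (subst tensor_coeff_eq) simp_all
  also have "\<dots> = (\<Sum>p\<in>decomp (\<alpha> + \<beta>). \<Sum>k\<in>I i (fst p).
      coef (gen S k (snd p)) {#leaf (j, \<beta>)#} * coef (gen S i (fst p)) {#leaf (i, \<alpha>)#})"
    unfolding z by (simp add: lookup_add lookup_sum lookup_tensor coef_one case_prod_beta)
  also have "\<dots> = (\<Sum>p\<in>decomp (\<alpha> + \<beta>). if p = (\<alpha>, \<beta>) then (if j \<in> I i \<alpha> then 1 else 0) else 0)"
  proof (rule sum.cong[OF refl])
    fix p
    have "(\<Sum>k\<in>I i (fst p). coef (gen S k (snd p)) {#leaf (j, \<beta>)#} * coef (gen S i (fst p)) {#leaf (i, \<alpha>)#})
      = (\<Sum>k\<in>I i (fst p). if k = j then (if p = (\<alpha>, \<beta>) then 1 else 0) else 0)"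
      unfolding S_def by (rule sum.cong) (auto simp: coef_gen_leaf prod_eq_iff)
    then show "(\<Sum>k\<in>I i (fst p). coef (gen S k (snd p)) {#leaf (j, \<beta>)#} * coef (gen S i (fst p)) {#leaf (i, \<alpha>)#})
      = (if p = (\<alpha>, \<beta>) then (if j \<in> I i \<alpha> then 1 else 0) else 0)"
      by simp
  qed
  also have "\<dots> = (if j \<in> I i \<alpha> then 1 else 0)"
    by (simp add: decomp_iff)
  finally show ?thesis .
qed

text \<open>A sum over an infinite set being \<open>0\<close>, closure holds for arbitrary functions \<open>\<phi>\<close> and \<open>\<psi>\<close>.\<close>

lemma dual_prod_in_dual_prelie:
  fixes I :: "'m::finite \<Rightarrow> 'n::finite mdeg \<Rightarrow> 'm set"
  shows "dual_prod (linear_sdse I :: ('m, 'n, 'k::field) sdse) \<phi> \<psi> \<in> dual_prelie (linear_sdse I)"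
  unfolding dual_prod_def case_prod_beta
  by (intro fn.subspace_sum fn.subspace_scale subspace_dual_prelie dual_gen_in_dual_prelie)

text \<open>The product is dual to the part of the coproduct of a generator that is linear in the
  generators in both tensor factors.\<close>

lemma dual_prod_gen:
  fixes I :: "'m::finite \<Rightarrow> 'n::finite mdeg \<Rightarrow> 'm set"
  defines "S \<equiv> linear_sdse I :: ('m, 'n, 'k::field) sdse"
  assumes I: "compatible I" and \<phi>: "\<phi> \<in> dual_prelie S" and \<psi>: "\<psi> \<in> dual_prelie S"
  shows "dual_prod S \<phi> \<psi> (gen S k \<gamma>) =
    (\<Sum>(\<alpha>, \<beta>)\<in>decomp \<gamma>. \<Sum>j\<in>I k \<alpha>. \<phi> (gen S j \<beta>) * \<psi> (gen S k \<alpha>))"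
proof -
  let ?A = "{(j, \<beta>). \<phi> (gen S j \<beta>) \<noteq> 0}" and ?B = "{(i, \<alpha>). \<psi> (gen S i \<alpha>) \<noteq> 0}"
  let ?C = "SIGMA p:decomp \<gamma>. I k (fst p)"
  let ?c = "\<lambda>((j, \<beta>), (i, \<alpha>)). i = k \<and> \<alpha> + \<beta> = \<gamma> \<and> j \<in> I k \<alpha>"
  let ?g = "\<lambda>((j, \<beta>), (i, \<alpha>)). \<phi> (gen S j \<beta>) * \<psi> (gen S i \<alpha>)"
  let ?h = "\<lambda>((\<alpha>, \<beta>), j). \<phi> (gen S j \<beta>) * \<psi> (gen S k \<alpha>)"
  have fin: "finite ?A" "finite ?B"
    using finite_dual_prelie_support[of _ I] \<phi> \<psi> by (auto simp: S_def)
  have "dual_prod S \<phi> \<psi> (gen S k \<gamma>) = (\<Sum>q\<in>?A. \<Sum>p\<in>?B. if ?c (q, p) then ?g (q, p) else 0)"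
    unfolding dual_prod_def case_prod_beta sum_fun_apply fun_scale_def S_def
    by (intro sum.cong refl) (auto simp: dual_gen_gen struct_const_eq[OF I])
  also have "\<dots> = (\<Sum>x\<in>?A \<times> ?B. if ?c x then ?g x else 0)"
    unfolding sum.cartesian_product by (intro sum.cong) (auto split: if_splits)
  also have "\<dots> = sum ?g {x \<in> ?A \<times> ?B. ?c x}"
    by (rule sum.inter_filter[symmetric]) (use fin in simp)
  also have "\<dots> = sum ?h ?C"
    by (rule sum.reindex_bij_witness_not_neutral[where
          S' = "{}" and T' = "{y \<in> ?C. ?h y = 0}" and
          j = "\<lambda>((j, \<beta>), (i, \<alpha>)). ((\<alpha>, \<beta>), j)" and i = "\<lambda>((\<alpha>, \<beta>), j). ((j, \<beta>), (k, \<alpha>))"])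
      (auto simp: decomp_iff intro: finite_subset[of _ ?C])
  also have "\<dots> = (\<Sum>p\<in>decomp \<gamma>. \<Sum>j\<in>I k (fst p). ?h (p, j))"
    by (simp add: sum.Sigma)
  finally show ?thesis by (simp add: case_prod_beta)
qed

text \<open>Both sides are the sum over \<open>\<alpha> + \<gamma> + \<epsilon> = \<delta>\<close>, \<open>j \<in> I k \<alpha>\<close> and \<open>l\<close>, where \<open>l\<close> ranges over
  \<open>I j \<gamma>\<close> on the left and over \<open>I k (\<alpha> + \<gamma>)\<close> on the right.\<close>

lemma dual_prod_assoc:
  fixes I :: "'m::finite \<Rightarrow> 'n::finite mdeg \<Rightarrow> 'm set"
  defines "S \<equiv> linear_sdse I :: ('m, 'n, 'k::field) sdse"
  assumes I: "compatible I"
    and xyz: "x \<in> dual_prelie S" "y \<in> dual_prelie S" "z \<in> dual_prelie S"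
  shows "dual_prod S (dual_prod S x y) z = dual_prod S x (dual_prod S y z)"
proof (rule dual_prelie_eqI[where I = I and 'k = 'k, folded S_def])
  have cl: "dual_prod S \<phi> \<psi> \<in> dual_prelie S" for \<phi> \<psi>
    unfolding S_def by (rule dual_prod_in_dual_prelie)
  then show "dual_prod S (dual_prod S x y) z \<in> dual_prelie S" "dual_prod S x (dual_prod S y z) \<in> dual_prelie S"
    by auto
  note eval = dual_prod_gen[OF I, where 'k = 'k, folded S_def]
  fix k \<delta>
  let ?f = "\<lambda>\<alpha> \<gamma> \<epsilon>. \<Sum>j\<in>I k \<alpha>. \<Sum>l\<in>I k (\<alpha> + \<gamma>). x (gen S l \<epsilon>) * (y (gen S j \<gamma>) * z (gen S k \<alpha>))"
  have "dual_prod S (dual_prod S x y) z (gen S k \<delta>)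
    = (\<Sum>(\<alpha>, \<beta>)\<in>decomp \<delta>. \<Sum>j\<in>I k \<alpha>. \<Sum>(\<gamma>, \<epsilon>)\<in>decomp \<beta>. \<Sum>l\<in>I j \<gamma>.
         x (gen S l \<epsilon>) * (y (gen S j \<gamma>) * z (gen S k \<alpha>)))"
    using xyz cl by (simp add: eval case_prod_beta sum_distrib_right mult.assoc)
  also have "\<dots> = (\<Sum>(\<alpha>, \<beta>)\<in>decomp \<delta>. \<Sum>j\<in>I k \<alpha>. \<Sum>(\<gamma>, \<epsilon>)\<in>decomp \<beta>. \<Sum>l\<in>I k (\<alpha> + \<gamma>).
         x (gen S l \<epsilon>) * (y (gen S j \<gamma>) * z (gen S k \<alpha>)))"
    using I by (simp add: compatible_def case_prod_beta cong: sum.cong)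
  also have "\<dots> = (\<Sum>(\<alpha>, \<beta>)\<in>decomp \<delta>. \<Sum>(\<gamma>, \<epsilon>)\<in>decomp \<beta>. ?f \<alpha> \<gamma> \<epsilon>)"
    unfolding case_prod_beta by (rule sum.cong[OF refl], rule sum.swap)
  also have "\<dots> = (\<Sum>(\<zeta>, \<epsilon>)\<in>decomp \<delta>. \<Sum>(\<alpha>, \<gamma>)\<in>decomp \<zeta>. ?f \<alpha> \<gamma> \<epsilon>)"
    by (rule sum_decomp_assoc)
  also have "\<dots> = (\<Sum>p\<in>decomp \<delta>. \<Sum>q\<in>decomp (fst p). \<Sum>j\<in>I k (fst q). \<Sum>l\<in>I k (fst p).
      x (gen S l (snd p)) * (y (gen S j (snd q)) * z (gen S k (fst q))))"
    unfolding case_prod_beta by (intro sum.cong refl) (auto simp: decomp_def)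
  also have "\<dots> = (\<Sum>p\<in>decomp \<delta>. \<Sum>l\<in>I k (fst p). \<Sum>q\<in>decomp (fst p). \<Sum>j\<in>I k (fst q).
      x (gen S l (snd p)) * (y (gen S j (snd q)) * z (gen S k (fst q))))"
    by (rule sum.cong[OF refl], rule trans[OF _ sum.swap], rule sum.cong[OF refl], rule sum.swap)
  also have "\<dots> = dual_prod S x (dual_prod S y z) (gen S k \<delta>)"
    using xyz cl by (simp add: eval case_prod_beta sum_distrib_left)
  finally show "dual_prod S (dual_prod S x y) z (gen S k \<delta>) = dual_prod S x (dual_prod S y z) (gen S k \<delta>)" .
qed

lemma fun_scale_apply: "fun_scale c f x = c * f x"
  by (simp add: fun_scale_def)

lemma left_prelie_dual_prod:
  fixes I :: "'m::finite \<Rightarrow> 'n::finite mdeg \<Rightarrow> 'm set"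
  defines "S \<equiv> linear_sdse I :: ('m, 'n, 'k::field) sdse"
  assumes I: "compatible I"
  shows "left_prelie_algebra (dual_prelie S) (dual_prod S)"
proof -
  let ?V = "dual_prelie S"
  have sub: "fn.subspace ?V" by (rule subspace_dual_prelie)
  have cl: "dual_prod S \<phi> \<psi> \<in> ?V" for \<phi> \<psi>
    unfolding S_def by (rule dual_prod_in_dual_prelie)
  note eval = dual_prod_gen[OF I, where 'k = 'k, folded S_def]
  note eqI = dual_prelie_eqI[where I = I and 'k = 'k, folded S_def]
  note closed = cl fn.subspace_add[OF sub] fn.subspace_scale[OF sub]
  have "dual_prod S (x + y) z = dual_prod S x z + dual_prod S y z"
    "dual_prod S z (x + y) = dual_prod S z x + dual_prod S z y"
    if "x \<in> ?V" "y \<in> ?V" "z \<in> ?V" for x y z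
    by (rule eqI; use that in \<open>simp add: closed eval case_prod_beta algebra_simps sum.distrib\<close>)+
  moreover have "dual_prod S (fun_scale c x) y = fun_scale c (dual_prod S x y)"
    "dual_prod S x (fun_scale c y) = fun_scale c (dual_prod S x y)"
    if "x \<in> ?V" "y \<in> ?V" for c x y
    by (rule eqI; use that in \<open>simp add: closed eval case_prod_beta fun_scale_apply sum_distrib_left ac_simps\<close>)+
  ultimately show ?thesis
    using sub cl dual_prod_assoc[OF I, where 'k = 'k, folded S_def] by (simp add: left_prelie_algebra_def)
qed

lemma dual_prod_dual_gen:
  fixes I :: "'m::finite \<Rightarrow> 'n::finite mdeg \<Rightarrow> 'm set"
  defines "S \<equiv> linear_sdse I :: ('m, 'n, 'k::field) sdse"
  assumes I: "compatible I"
  shows "dual_prod S (dual_gen S j \<beta>) (dual_gen S i \<alpha>) = (if j \<in> I i \<alpha> then dual_gen S i (\<alpha> + \<beta>) else 0)"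
proof -
  have A: "{(l, \<gamma>). dual_gen S k \<delta> (gen S l \<gamma>) \<noteq> 0} = {(k, \<delta>)}" for k \<delta>
    by (auto simp: S_def dual_gen_gen)
  have "dual_prod S (dual_gen S j \<beta>) (dual_gen S i \<alpha>)
      = fun_scale (if j \<in> I i \<alpha> then 1 else 0) (dual_gen S i (\<alpha> + \<beta>))"
    unfolding dual_prod_def A by (simp add: S_def dual_gen_gen struct_const_eq[OF I])
  then show ?thesis by simp
qed

theorem proposition46:
  fixes I :: "'m::finite \<Rightarrow> 'n::finite mdeg \<Rightarrow> 'm set"
    and S :: "('m, 'n, 'k::field_char_0) sdse"
  assumes nonempty: "\<And>i \<alpha>. I i \<alpha> \<noteq> {}"
    and S: "S = linear_sdse I"
  shows "(hopf_sdse S \<longleftrightarrow> (\<exists>G :: ('m, 'n) cgraph. hopf_graph G \<and> S = graph_sdse G)) \<and>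
    (\<forall>G :: ('m, 'n) cgraph. hopf_graph G \<and> S = graph_sdse G \<longrightarrow>
       left_prelie_algebra (dual_prelie S) (dual_prod S) \<and>
       associative_on (dual_prelie S) (dual_prod S) \<and>
       is_basis (\<lambda>(i, \<alpha>). dual_gen S i \<alpha>) (dual_prelie S) \<and>
       (\<forall>i j \<alpha> \<beta>. dual_prod S (dual_gen S j \<beta>) (dual_gen S i \<alpha>) =
          (if reach G i (mvec \<alpha>) j then dual_gen S i (\<alpha> + \<beta>) else 0)))"
proof -
  have graph: "compatible I" "\<And>i j \<alpha>. reach G i (mvec \<alpha>) j \<longleftrightarrow> j \<in> I i \<alpha>"
    if "hopf_graph G" "S = graph_sdse G" for G :: "('m, 'n) cgraph"
  proof -
    have "I = (\<lambda>i \<alpha>. {j. reach G i (mvec \<alpha>) j})"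
      using that(2) unfolding S graph_sdse_def by (rule linear_sdse_inject)
    with hopf_graph_imp_compatible[OF that(1)]
    show "compatible I" "\<And>i j \<alpha>. reach G i (mvec \<alpha>) j \<longleftrightarrow> j \<in> I i \<alpha>" by simp_all
  qed
  have "\<exists>G :: ('m, 'n) cgraph. hopf_graph G \<and> S = graph_sdse G" if "hopf_sdse S"
  proof -
    have I: "compatible I" using that unfolding S by (rule hopf_imp_compatible)
    have reach: "reach (unit_graph I) i (mvec \<alpha>) j \<longleftrightarrow> j \<in> I i \<alpha>" for i \<alpha> j
      using I nonempty by (rule reach_unit_graph)
    have "hopf_graph (unit_graph I)"
      unfolding hopf_graph_def reach using I by (auto simp: compatible_def)
    moreover have "S = graph_sdse (unit_graph I)"
      by (simp add: S graph_sdse_def reach)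
    ultimately show ?thesis by blast
  qed
  moreover have "hopf_sdse S" if "hopf_graph G" "S = graph_sdse G" for G :: "('m, 'n) cgraph"
    using graph(1)[OF that] unfolding S by (rule compatible_imp_hopf)
  moreover have "left_prelie_algebra (dual_prelie S) (dual_prod S)"
    "associative_on (dual_prelie S) (dual_prod S)"
    "dual_prod S (dual_gen S j \<beta>) (dual_gen S i \<alpha>)
       = (if reach G i (mvec \<alpha>) j then dual_gen S i (\<alpha> + \<beta>) else 0)"
    if "hopf_graph G" "S = graph_sdse G" for G :: "('m, 'n) cgraph" and i j \<alpha> \<beta>
    using graph[OF that] unfolding S associative_on_def
    by (auto simp: left_prelie_dual_prod dual_prod_assoc dual_prod_dual_gen)
  ultimately show ?thesis
    using is_basis_dual_gen[of I] unfolding S by blast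
qed

end
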